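(* Suppose that the data $(\lambda,\kappa;S_i,W_i,N_i,E_i,\tau^J_i)$ (with all entries nonzero) satisfies all the $D^{(1)}_n$ bilinear equations $\langle J,i\rangle$ ($1\le J\le4$, $0\le i\le n$). Define elements of $\mathcal B$ by $$x=[\lambda;\tau^3,W,\tau^2],\quad y=[\kappa;\tau^2,N,\tau^1],\quad x'=[\kappa;\tau^3,S,\tau^4],\quad y'=[\lambda;\tau^4,E,\tau^1].$$ Then $R(x,y)=(x',y')$, where $R$ is the $D^{(1)}_n$ tropical $R$.
   Context: Fix an integer $n\ge 3$; all quantities are complex numbers. $\mathcal B$ is the set of tuples $x=(x_1,\dots,x_n,\bar x_{n-1},\dots,\bar x_1)$ of nonzero numbers, and $\ell(x)=x_1\cdots x_n\bar x_{n-1}\cdots\bar x_1$ is the level. Fix $\lambda,\kappa\in\mathcal B$, put $l=\ell(\lambda)$, $k=\ell(\kappa)$, and assume $lk(l-k)\neq0$. Let $\alpha,\beta$ be nonzero parameters. Tau functions are variables $S_i,W_i,N_i,E_i$ ($1\le i\le n-2$) and $\tau^J_i$ ($0\le J\le 4$, $0\le i\le n$). The $D^{(1)}_n$ bilinear equations $\langle J,i\rangle$ are: $\langle1,0\rangle$: $\bar\kappa_1N_1\tau^4_1-\bar\lambda_1E_1\tau^2_1=\alpha\tau^0_0\tau^1_0$; $\langle1,1\rangle$: $\kappa_1N_1\tau^4_0-\lambda_1E_1\tau^2_0=\alpha\tau^0_1\tau^1_1$; $\langle1,i\rangle$ ($2\le i\le n-2$): $\kappa_iE_{i-1}N_i-\lambda_iN_{i-1}E_i=\alpha\tau^0_i\tau^1_i$;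 $\langle1,n-1\rangle$: $\kappa_{n-1}\kappa_nE_{n-2}\tau^2_n-\lambda_{n-1}\lambda_nN_{n-2}\tau^4_n=\alpha\tau^0_{n-1}\tau^1_n$; $\langle1,n\rangle$: $\kappa_{n-1}E_{n-2}\tau^2_{n-1}-\lambda_{n-1}N_{n-2}\tau^4_{n-1}=\alpha\tau^0_n\tau^1_{n-1}$; $\langle2,0\rangle$: $\kappa_1N_1\tau^3_1+\bar\lambda_1W_1\tau^1_1=\beta\tau^0_0\tau^2_0$; $\langle2,1\rangle$: $\bar\kappa_1N_1\tau^3_0+\lambda_1W_1\tau^1_0=\beta\tau^0_1\tau^2_1$; $\langle2,i\rangle$ ($2\le i\le n-2$): $\bar\kappa_iW_{i-1}N_i+\lambda_iN_{i-1}W_i=\beta\tau^0_i\tau^2_i$; $\langle2,n-1\rangle$: $\kappa_n\bar\kappa_{n-1}W_{n-2}\tau^1_{n-1}+\lambda_{n-1}N_{n-2}\tau^3_{n-1}=\beta\tau^0_{n-1}\tau^2_{n-1}$; $\langle2,n\rangle$: $\bar\kappa_{n-1}W_{n-2}\tau^1_n+\lambda_{n-1}\lambda_nN_{n-2}\tau^3_n=\beta\tau^0_n\tau^2_n$; $\langle3,0\rangle$: $\kappa_1S_1\tau^2_1-\lambda_1W_1\tau^4_1=\alpha\tau^0_0\tau^3_0$; $\langle3,1\rangle$: $\bar\kappa_1S_1\tau^2_0-\bar\lambda_1W_1\tau^4_0=\alpha\tau^0_1\tau^3_1$; $\langle3,i\rangle$ ($2\le i\le n-2$): $\bar\kappa_iW_{i-1}S_i-\bar\lambda_iS_{i-1}W_i=\alpha\tau^0_i\tau^3_i$;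 $\langle3,n-1\rangle$: $\bar\kappa_{n-1}W_{n-2}\tau^4_n-\bar\lambda_{n-1}S_{n-2}\tau^2_n=\alpha\tau^0_{n-1}\tau^3_n$; $\langle3,n\rangle$: $\kappa_n\bar\kappa_{n-1}W_{n-2}\tau^4_{n-1}-\lambda_n\bar\lambda_{n-1}S_{n-2}\tau^2_{n-1}=\alpha\tau^0_n\tau^3_{n-1}$; $\langle4,0\rangle$: $\bar\kappa_1S_1\tau^1_1+\lambda_1E_1\tau^3_1=\beta\tau^0_0\tau^4_0$; $\langle4,1\rangle$: $\kappa_1S_1\tau^1_0+\bar\lambda_1E_1\tau^3_0=\beta\tau^0_1\tau^4_1$; $\langle4,i\rangle$ ($2\le i\le n-2$): $\kappa_iE_{i-1}S_i+\bar\lambda_iS_{i-1}E_i=\beta\tau^0_i\tau^4_i$; $\langle4,n-1\rangle$: $\kappa_{n-1}E_{n-2}\tau^3_{n-1}+\lambda_n\bar\lambda_{n-1}S_{n-2}\tau^1_{n-1}=\beta\tau^0_{n-1}\tau^4_{n-1}$; $\langle4,n\rangle$: $\kappa_{n-1}\kappa_nE_{n-2}\tau^3_n+\bar\lambda_{n-1}S_{n-2}\tau^1_n=\beta\tau^0_n\tau^4_n$. Parameterization. For $\mu\in\mathcal B$, $C=(C_1,\dots,C_{n-2})$, $\tau=(\tau_0,\dots,\tau_n)$, $\tau'=(\tau'_0,\dots,\tau'_n)$, the element $[\mu;\tau,C,\tau']=(z_1,\dots,z_n,\bar z_{n-1},\dots,\bar z_1)\in\mathcal B$ is, for $n\ge4$: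 $z_1=\mu_1^{-1}\frac{\tau_0\tau'_1}{C_1}$, $\bar z_1=\bar\mu_1^{-1}\frac{\tau_1\tau'_0}{C_1}$, $z_2=\mu_2^{-1}\frac{C_1\tau'_2}{C_2\tau'_0\tau'_1}$, $\bar z_2=\bar\mu_2^{-1}\frac{C_1\tau_2}{C_2\tau_0\tau_1}$, and $z_i=\mu_i^{-1}\frac{C_{i-1}\tau'_i}{C_i\tau'_{i-1}}$, $\bar z_i=\bar\mu_i^{-1}\frac{C_{i-1}\tau_i}{C_i\tau_{i-1}}$ ($3\le i\le n-2$), $z_{n-1}=\mu_{n-1}^{-1}\frac{C_{n-2}\tau'_{n-1}}{\tau_{n-1}\tau'_{n-2}}$, $\bar z_{n-1}=\bar\mu_{n-1}^{-1}\frac{C_{n-2}\tau_n}{\tau_{n-2}\tau'_n}$, $z_n=\mu_n^{-1}\frac{\tau_{n-1}\tau'_n}{\tau_n\tau'_{n-1}}$. For $n=3$: $z_1=\mu_1^{-1}\frac{\tau_0\tau'_1}{C_1}$, $\bar z_1=\bar\mu_1^{-1}\frac{\tau_1\tau'_0}{C_1}$, $z_2=\mu_2^{-1}\frac{C_1\tau'_2}{\tau_2\tau'_0\tau'_1}$, $\bar z_2=\bar\mu_2^{-1}\frac{C_1\tau_3}{\tau_0\tau_1\tau'_3}$, $z_3=\mu_3^{-1}\frac{\tau_2\tau'_3}{\tau_3\tau'_2}$. Here $\tau^J=(\tau^J_0,\dots,\tau^J_n)$, $W=(W_1,\dots,W_{n-2})$, etc. Tropical $R$. Involutions: $\sigma_1$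 on $\mathcal B$ exchanges $x_1\leftrightarrow\bar x_1$; $\sigma_n$ on $\mathcal B$ sends $x_{n-1}\mapsto x_{n-1}x_n$, $\bar x_{n-1}\mapsto\bar x_{n-1}x_n$, $x_n\mapsto1/x_n$; both fix the other entries and act diagonally on $\mathcal B\times\mathcal B$; $\sigma_\ast$ on $\mathcal B\times\mathcal B$ exchanges $x_i\leftrightarrow\bar y_i$, $\bar x_i\leftrightarrow y_i$ ($1\le i\le n-1$), $x_n\leftrightarrow y_n$. For a function $F(x,y)$ put $F^{\sigma_a}(x,y)=F(\sigma_a(x,y))$. Set $$V_0=\ell(x)\tfrac{y_1}{\bar y_1}+\ell(x)\sum_{m=2}^{n-1}\Bigl(\prod_{i=1}^{m-1}\tfrac{y_i}{x_i}\Bigr)\Bigl(1+\tfrac{y_m}{\bar y_m}\Bigr)+x_ny_n\prod_{i=1}^{n-1}\bar x_iy_i+\ell(y)\tfrac{\bar x_1}{x_1}+\ell(y)\sum_{m=2}^{n-1}\Bigl(\prod_{i=1}^{m-1}\tfrac{\bar x_i}{\bar y_i}\Bigr)\Bigl(1+\tfrac{\bar x_m}{x_m}\Bigr)+\prod_{i=1}^{n-1}\bar x_iy_i,$$ $V_i=\bar y_i\bigl(\frac1{\bar x_i}V_{i-1}+(\ell(x)-\ell(y))(\frac1{x_i}+\frac1{\bar y_i})\bigr)$ for $1\le i\le n-2$, $V_{n-1}=\frac{\bar y_{n-1}}{y_n}\bigl(\frac{y_n}{\bar x_{n-1}}V_{n-2}+(\ell(x)-\ell(y))(\frac{y_n}{x_{n-1}}+\frac1{\bar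 y_{n-1}})\bigr)$; $U_1=V_0V_0^{\sigma_1}$, $U_{n-1}=V_{n-1}V_{n-1}^{\sigma_\ast}$, $U_i=(\frac1{x_i}+\frac1{\bar y_i})^{-1}\bigl(\frac1{y_i}V_iV_{i-1}^{\sigma_\ast}+\frac1{\bar x_i}V_{i-1}V_i^{\sigma_\ast}\bigr)$ for $2\le i\le n-2$. The tropical $R$ is the birational map $R(x,y)=(x',y')$ on $\mathcal B\times\mathcal B$ given by $x_1'=y_1\frac{V_0^{\sigma_1}}{V_1}$, $\bar x_1'=\bar y_1\frac{V_0}{V_1}$, $x_i'=y_i\frac{V_{i-1}U_i}{V_iU_{i-1}}$, $\bar x'_i=\bar y_i\frac{V_{i-1}}{V_i}$ ($2\le i\le n-1$), $x'_n=y_n\frac{V_{n-1}}{V_{n-1}^{\sigma_n}}$, $y_1'=x_1\frac{V_0}{V_1^{\sigma_\ast}}$, $\bar y'_1=\bar x_1\frac{V_0^{\sigma_1}}{V_1^{\sigma_\ast}}$, $y'_i=x_i\frac{V_{i-1}^{\sigma_\ast}}{V_i^{\sigma_\ast}}$, $\bar y'_i=\bar x_i\frac{V_{i-1}^{\sigma_\ast}U_i}{V_i^{\sigma_\ast}U_{i-1}}$ ($2\le i\le n-1$), $y'_n=x_n\frac{V_{n-1}^{\sigma_n}}{V_{n-1}}$. *)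

theory Defs
  imports Complex_Main "HOL-Library.FuncSet"
begin

text \<open>
  A tuple $(x_1,\dots,x_n,\bar x_{n-1},\dots,\bar x_1)$ is represented as the pair of its unbarred
  and its barred entries, indexed by \<open>{1..n}\<close> and \<open>{1..n-1}\<close>. Both components are extensional
  (\<open>undefined\<close> outside the index range), so that equality of tuples is HOL equality.
  A trailing \<open>b\<close> in a variable name stands for a bar.
\<close>

type_synonym tuple = "(nat \<Rightarrow> complex) \<times> (nat \<Rightarrow> complex)"

definition calB :: "nat \<Rightarrow> tuple set" where
  "calB n = ({1..n} \<rightarrow>\<^sub>E - {0}) \<times> ({1..n-1} \<rightarrow>\<^sub>E - {0})"

fun level :: "nat \<Rightarrow> tuple \<Rightarrow> complex" where
  "level n (x, xb) = (\<Prod>i=1..n. x i) * (\<Prod>i=1..n-1. xb i)"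

section \<open>The bilinear equations\<close>

text \<open>
  The tau functions are \<open>S i\<close>, \<open>W i\<close>, \<open>N i\<close>, \<open>E i\<close> for \<open>1 \<le> i \<le> n - 2\<close>, and \<open>t J i\<close> for
  $\tau^J_i$ with \<open>J \<le> 4\<close>, \<open>i \<le> n\<close>. The predicates \<open>bilinear1\<close>, \dots, \<open>bilinear4\<close>
  are the equations $\langle J,i\rangle$, $0 \le i \le n$, for $J = 1,\dots,4$.
\<close>

fun bilinear1 :: "nat \<Rightarrow> complex \<Rightarrow> tuple \<Rightarrow> tuple \<Rightarrow> (nat \<Rightarrow> complex) \<Rightarrow>
    (nat \<Rightarrow> complex) \<Rightarrow> (nat \<Rightarrow> nat \<Rightarrow> complex) \<Rightarrow> bool" where
  "bilinear1 n \<alpha> (lam, lamb) (kap, kapb) N E t \<longleftrightarrow>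
     kapb 1 * N 1 * t 4 1 - lamb 1 * E 1 * t 2 1 = \<alpha> * t 0 0 * t 1 0 \<and>
     kap 1 * N 1 * t 4 0 - lam 1 * E 1 * t 2 0 = \<alpha> * t 0 1 * t 1 1 \<and>
     (\<forall>i\<in>{2..n-2}. kap i * E (i-1) * N i - lam i * N (i-1) * E i = \<alpha> * t 0 i * t 1 i) \<and>
     kap (n-1) * kap n * E (n-2) * t 2 n - lam (n-1) * lam n * N (n-2) * t 4 n
       = \<alpha> * t 0 (n-1) * t 1 n \<and>
     kap (n-1) * E (n-2) * t 2 (n-1) - lam (n-1) * N (n-2) * t 4 (n-1)
       = \<alpha> * t 0 n * t 1 (n-1)"

fun bilinear2 :: "nat \<Rightarrow> complex \<Rightarrow> tuple \<Rightarrow> tuple \<Rightarrow> (nat \<Rightarrow> complex) \<Rightarrow>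
    (nat \<Rightarrow> complex) \<Rightarrow> (nat \<Rightarrow> nat \<Rightarrow> complex) \<Rightarrow> bool" where
  "bilinear2 n \<beta> (lam, lamb) (kap, kapb) W N t \<longleftrightarrow>
     kap 1 * N 1 * t 3 1 + lamb 1 * W 1 * t 1 1 = \<beta> * t 0 0 * t 2 0 \<and>
     kapb 1 * N 1 * t 3 0 + lam 1 * W 1 * t 1 0 = \<beta> * t 0 1 * t 2 1 \<and>
     (\<forall>i\<in>{2..n-2}. kapb i * W (i-1) * N i + lam i * N (i-1) * W i = \<beta> * t 0 i * t 2 i) \<and>
     kap n * kapb (n-1) * W (n-2) * t 1 (n-1) + lam (n-1) * N (n-2) * t 3 (n-1)
       = \<beta> * t 0 (n-1) * t 2 (n-1) \<and>
     kapb (n-1) * W (n-2) * t 1 n + lam (n-1) * lam n * N (n-2) * t 3 n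
       = \<beta> * t 0 n * t 2 n"

fun bilinear3 :: "nat \<Rightarrow> complex \<Rightarrow> tuple \<Rightarrow> tuple \<Rightarrow> (nat \<Rightarrow> complex) \<Rightarrow>
    (nat \<Rightarrow> complex) \<Rightarrow> (nat \<Rightarrow> nat \<Rightarrow> complex) \<Rightarrow> bool" where
  "bilinear3 n \<alpha> (lam, lamb) (kap, kapb) S W t \<longleftrightarrow>
     kap 1 * S 1 * t 2 1 - lam 1 * W 1 * t 4 1 = \<alpha> * t 0 0 * t 3 0 \<and>
     kapb 1 * S 1 * t 2 0 - lamb 1 * W 1 * t 4 0 = \<alpha> * t 0 1 * t 3 1 \<and>
     (\<forall>i\<in>{2..n-2}. kapb i * W (i-1) * S i - lamb i * S (i-1) * W i = \<alpha> * t 0 i * t 3 i) \<and>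
     kapb (n-1) * W (n-2) * t 4 n - lamb (n-1) * S (n-2) * t 2 n
       = \<alpha> * t 0 (n-1) * t 3 n \<and>
     kap n * kapb (n-1) * W (n-2) * t 4 (n-1) - lam n * lamb (n-1) * S (n-2) * t 2 (n-1)
       = \<alpha> * t 0 n * t 3 (n-1)"

fun bilinear4 :: "nat \<Rightarrow> complex \<Rightarrow> tuple \<Rightarrow> tuple \<Rightarrow> (nat \<Rightarrow> complex) \<Rightarrow>
    (nat \<Rightarrow> complex) \<Rightarrow> (nat \<Rightarrow> nat \<Rightarrow> complex) \<Rightarrow> bool" where
  "bilinear4 n \<beta> (lam, lamb) (kap, kapb) S E t \<longleftrightarrow>
     kapb 1 * S 1 * t 1 1 + lam 1 * E 1 * t 3 1 = \<beta> * t 0 0 * t 4 0 \<and>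
     kap 1 * S 1 * t 1 0 + lamb 1 * E 1 * t 3 0 = \<beta> * t 0 1 * t 4 1 \<and>
     (\<forall>i\<in>{2..n-2}. kap i * E (i-1) * S i + lamb i * S (i-1) * E i = \<beta> * t 0 i * t 4 i) \<and>
     kap (n-1) * E (n-2) * t 3 (n-1) + lam n * lamb (n-1) * S (n-2) * t 1 (n-1)
       = \<beta> * t 0 (n-1) * t 4 (n-1) \<and>
     kap (n-1) * kap n * E (n-2) * t 3 n + lamb (n-1) * S (n-2) * t 1 n
       = \<beta> * t 0 n * t 4 n"

definition bilinear_eqs :: "nat \<Rightarrow> complex \<Rightarrow> complex \<Rightarrow> tuple \<Rightarrow> tuple \<Rightarrow>
    (nat \<Rightarrow> complex) \<Rightarrow> (nat \<Rightarrow> complex) \<Rightarrow> (nat \<Rightarrow> complex) \<Rightarrow> (nat \<Rightarrow> complex) \<Rightarrow>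
    (nat \<Rightarrow> nat \<Rightarrow> complex) \<Rightarrow> bool" where
  "bilinear_eqs n \<alpha> \<beta> lam kap S W N E t \<longleftrightarrow>
     bilinear1 n \<alpha> lam kap N E t \<and> bilinear2 n \<beta> lam kap W N t \<and>
     bilinear3 n \<alpha> lam kap S W t \<and> bilinear4 n \<beta> lam kap S E t"

section \<open>The parameterization $[\mu;\tau,C,\tau']$\<close>

fun tau_param :: "nat \<Rightarrow> tuple \<Rightarrow> (nat \<Rightarrow> complex) \<Rightarrow> (nat \<Rightarrow> complex) \<Rightarrow>
    (nat \<Rightarrow> complex) \<Rightarrow> tuple" where
  "tau_param n (\<mu>, \<mu>b) t C t' =
    (if n = 3 then
      (\<lambda>i\<in>{1..3}.
         if i = 1 then inverse (\<mu> 1) * (t 0 * t' 1 / C 1)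
         else if i = 2 then inverse (\<mu> 2) * (C 1 * t' 2 / (t 2 * t' 0 * t' 1))
         else inverse (\<mu> 3) * (t 2 * t' 3 / (t 3 * t' 2)),
       \<lambda>i\<in>{1..2}.
         if i = 1 then inverse (\<mu>b 1) * (t 1 * t' 0 / C 1)
         else inverse (\<mu>b 2) * (C 1 * t 3 / (t 0 * t 1 * t' 3)))
     else
      (\<lambda>i\<in>{1..n}.
         if i = 1 then inverse (\<mu> 1) * (t 0 * t' 1 / C 1)
         else if i = 2 then inverse (\<mu> 2) * (C 1 * t' 2 / (C 2 * t' 0 * t' 1))
         else if i \<le> n - 2 then inverse (\<mu> i) * (C (i-1) * t' i / (C i * t' (i-1)))
         else if i = n - 1 then
           inverse (\<mu> (n-1)) * (C (n-2) * t' (n-1) / (t (n-1) * t' (n-2)))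
         else inverse (\<mu> n) * (t (n-1) * t' n / (t n * t' (n-1))),
       \<lambda>i\<in>{1..n-1}.
         if i = 1 then inverse (\<mu>b 1) * (t 1 * t' 0 / C 1)
         else if i = 2 then inverse (\<mu>b 2) * (C 1 * t 2 / (C 2 * t 0 * t 1))
         else if i \<le> n - 2 then inverse (\<mu>b i) * (C (i-1) * t i / (C i * t (i-1)))
         else inverse (\<mu>b (n-1)) * (C (n-2) * t n / (t (n-2) * t' n))))"

section \<open>The tropical $R$\<close>

fun sigma1_tuple :: "tuple \<Rightarrow> tuple" where
  "sigma1_tuple (x, xb) = (x(1 := xb 1), xb(1 := x 1))"

fun sigman_tuple :: "nat \<Rightarrow> tuple \<Rightarrow> tuple" where
  "sigman_tuple n (x, xb) =
     (x(n - 1 := x (n-1) * x n, n := 1 / x n), xb(n - 1 := xb (n-1) * x n))"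

definition sigma1 :: "tuple \<times> tuple \<Rightarrow> tuple \<times> tuple" where
  "sigma1 = map_prod sigma1_tuple sigma1_tuple"

definition sigman :: "nat \<Rightarrow> tuple \<times> tuple \<Rightarrow> tuple \<times> tuple" where
  "sigman n = map_prod (sigman_tuple n) (sigman_tuple n)"

fun sigmastar :: "nat \<Rightarrow> tuple \<times> tuple \<Rightarrow> tuple \<times> tuple" where
  "sigmastar n ((x, xb), (y, yb)) =
     ((\<lambda>i\<in>{1..n}. if i = n then y n else yb i, \<lambda>i\<in>{1..n-1}. y i),
      (\<lambda>i\<in>{1..n}. if i = n then x n else xb i, \<lambda>i\<in>{1..n-1}. x i))"

fun V0 :: "nat \<Rightarrow> tuple \<times> tuple \<Rightarrow> complex" where
  "V0 n ((x, xb), (y, yb)) =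
     level n (x, xb) * (y 1 / yb 1)
     + level n (x, xb) * (\<Sum>m=2..n-1. (\<Prod>i=1..m-1. y i / x i) * (1 + y m / yb m))
     + x n * y n * (\<Prod>i=1..n-1. xb i * y i)
     + level n (y, yb) * (xb 1 / x 1)
     + level n (y, yb) * (\<Sum>m=2..n-1. (\<Prod>i=1..m-1. xb i / yb i) * (1 + xb m / x m))
     + (\<Prod>i=1..n-1. xb i * y i)"

text \<open>\<open>V n i\<close> is $V_i$; only the values for \<open>i \<le> n - 1\<close> are meaningful.\<close>

fun V :: "nat \<Rightarrow> nat \<Rightarrow> tuple \<times> tuple \<Rightarrow> complex" where
  "V n 0 p = V0 n p"
| "V n (Suc j) ((x, xb), (y, yb)) =
    (let i = Suc j; p = ((x, xb), (y, yb)); d = level n (x, xb) - level n (y, yb) in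
     if i = n - 1
     then yb i / y n * (y n / xb i * V n j p + d * (y n / x i + 1 / yb i))
     else yb i * (1 / xb i * V n j p + d * (1 / x i + 1 / yb i)))"

text \<open>\<open>U n i\<close> is $U_i$; only the values for \<open>1 \<le> i \<le> n - 1\<close> are meaningful.\<close>

fun U :: "nat \<Rightarrow> nat \<Rightarrow> tuple \<times> tuple \<Rightarrow> complex" where
  "U n i ((x, xb), (y, yb)) =
    (let p = ((x, xb), (y, yb)) in
     if i = 1 then V n 0 p * V n 0 (sigma1 p)
     else if i = n - 1 then V n (n-1) p * V n (n-1) (sigmastar n p)
     else inverse (1 / x i + 1 / yb i) *
       (1 / y i * V n i p * V n (i-1) (sigmastar n p)
        + 1 / xb i * V n (i-1) p * V n i (sigmastar n p)))"

fun tropical_R :: "nat \<Rightarrow> tuple \<times> tuple \<Rightarrow> tuple \<times> tuple" where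
  "tropical_R n ((x, xb), (y, yb)) =
    (let p = ((x, xb), (y, yb)) in
     ((\<lambda>i\<in>{1..n}.
         if i = 1 then y 1 * (V n 0 (sigma1 p) / V n 1 p)
         else if i \<le> n - 1 then y i * (V n (i-1) p * U n i p / (V n i p * U n (i-1) p))
         else y n * (V n (n-1) p / V n (n-1) (sigman n p)),
       \<lambda>i\<in>{1..n-1}.
         if i = 1 then yb 1 * (V n 0 p / V n 1 p)
         else yb i * (V n (i-1) p / V n i p)),
      (\<lambda>i\<in>{1..n}.
         if i = 1 then x 1 * (V n 0 p / V n 1 (sigmastar n p))
         else if i \<le> n - 1 then x i * (V n (i-1) (sigmastar n p) / V n i (sigmastar n p))
         else x n * (V n (n-1) (sigman n p) / V n (n-1) p),
       \<lambda>i\<in>{1..n-1}.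
         if i = 1 then xb 1 * (V n 0 (sigma1 p) / V n 1 (sigmastar n p))
         else xb i * (V n (i-1) (sigmastar n p) * U n i p
                      / (V n i (sigmastar n p) * U n (i-1) p)))))"

text \<open>
  The tropical $R$ is only a partially defined map on $\mathcal B\times\mathcal B$, whereas
  division in HOL is total. The following set consists of the points of
  $\mathcal B\times\mathcal B$ at which no denominator in the defining formulas vanishes and
  whose image lies in $\mathcal B\times\mathcal B$ again.
\<close>

definition tropical_R_domain :: "nat \<Rightarrow> (tuple \<times> tuple) set" where
  "tropical_R_domain n =
     {p \<in> calB n \<times> calB n.
        (\<forall>i\<in>{2..n-2}. 1 / fst (fst p) i + 1 / snd (snd p) i \<noteq> 0) \<and>
        (\<forall>i\<in>{1..n-1}. V n i p \<noteq> 0 \<and> V n i (sigmastar n p) \<noteq> 0) \<and>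
        (\<forall>i\<in>{1..n-2}. U n i p \<noteq> 0) \<and>
        V n (n-1) (sigman n p) \<noteq> 0 \<and>
        tropical_R n p \<in> calB n \<times> calB n}"

end

theory Submission
  imports Defs
begin

text \<open>
  The recursion for $V_i$ does not by itself determine $V_0$. However, $V_0 = V_0^{\sigma_*}$, and
  together the chains $V_0,\dots,V_{n-1}$ and $V_0^{\sigma_*},\dots,V_{n-1}^{\sigma_*}$ run once
  around the entries of the tuples. Joined by one linear relation between $V_{n-1}$ and
  $V_{n-1}^{\sigma_*}$, they give $V_0$ a linear equation with leading coefficient
  $\ell(x) - \ell(y) \neq 0$ whose unique solution is the explicit sum in the definition of $V_0$.
  It thus suffices to exhibit two chains in terms of tau functions. With
  $c = (\ell(x)-\ell(y))\beta/\alpha$ these are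
  $V_i = c\,S_i\tau^2_i/(N_i\tau^3_i)$ and $V_i^{\sigma_*} = c\,E_i\tau^2_i/(W_i\tau^1_i)$
  (with modified ends), the recursions being the bilinear equations with $J = 3$ and $J = 1$ after
  $1/x_i + 1/\bar y_i$ has been evaluated by those with $J = 2$.
  The involutions $\sigma_1$ and $\sigma_n$ amount to exchanging the tau functions with indices
  $0, 1$ and $n-1, n$, so they map solutions of the bilinear equations to solutions; and
  $U_i = c^2\tau^2_i\tau^4_i/(\tau^1_i\tau^3_i)$ by the equations with $J = 4$.
\<close>

section \<open>Uniqueness of $V_i$\<close>

text \<open>Multiplying a partial product by the next factor gives the next partial product, so the
  two sums of partial products differ by a shift of the index. The identity brings the sums in
  \<open>V0\<close>, with their irregular first terms, to the shape that iterating the recursions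
  produces.\<close>

lemma sum_prod_telescope:
  fixes a b :: "nat \<Rightarrow> complex"
  assumes "m \<ge> 1"
  shows "b 1 + (\<Sum>k=2..m. (\<Prod>i=1..k-1. a i) * (1 + b k))
    = (\<Sum>k=1..m. (\<Prod>i=1..k-1. a i) * (a k + b k)) - (\<Prod>i=1..m. a i)"
  using assms
proof (induction m rule: dec_induct)
  case base
  then show ?case by simp
next
  case (step m)
  then show ?case by (simp add: algebra_simps)
qed

text \<open>Here \<open>v\<close> is a candidate for the V_i and \<open>w\<close> for their
  conjugates under \<open>sigmastar\<close>, where \<open>x\<close> and \<open>yb\<close>,
  \<open>xb\<close> and \<open>y\<close> trade places and \<open>d\<close> changes sign. Unrolling
  expresses the common start by the end value of either chain. In the combination weighted by the
  two levels, \<open>close\<close> eliminates both end values.\<close>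

lemma V_eqI:
  fixes v w :: "nat \<Rightarrow> complex"
  assumes d_def: "d = level n (x, xb) - level n (y, yb)"
    and n: "n \<ge> 2" and d: "d \<noteq> 0"
    and nz: "\<And>i. 1 \<le> i \<Longrightarrow> i \<le> n \<Longrightarrow> x i \<noteq> 0 \<and> y i \<noteq> 0"
      "\<And>i. 1 \<le> i \<Longrightarrow> i \<le> n - 1 \<Longrightarrow> xb i \<noteq> 0 \<and> yb i \<noteq> 0"
    and start: "v 0 = w 0"
    and v: "\<And>i. 1 \<le> i \<Longrightarrow> i \<le> n - 2 \<Longrightarrow> v i / yb i = v (i-1) / xb i + d * (1 / x i + 1 / yb i)"
    and w: "\<And>i. 1 \<le> i \<Longrightarrow> i \<le> n - 2 \<Longrightarrow> w i / x i = w (i-1) / y i - d * (1 / x i + 1 / yb i)"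
    and v_last: "v (n-1) / yb (n-1) = v (n-2) / xb (n-1) + d * (1 / x (n-1) + 1 / (yb (n-1) * y n))"
    and w_last: "w (n-1) / x (n-1) = w (n-2) / y (n-1) - d * (1 / yb (n-1) + 1 / (x (n-1) * x n))"
    and close: "y n * v (n-1) - x n * w (n-1) = d * (1 - x n * y n)"
    and j: "j \<le> n - 1"
  shows "V n j ((x, xb), (y, yb)) = v j"
proof -
  define P where "P m = (\<Prod>i=1..m. xb i / yb i)" for m
  define Q where "Q m = (\<Prod>i=1..m. y i / x i)" for m
  have P_Suc: "P (Suc m) = P m * (xb (Suc m) / yb (Suc m))"
    and Q_Suc: "Q (Suc m) = Q m * (y (Suc m) / x (Suc m))" for m
    by (simp_all add: P_def Q_def)
  txt \<open>The shifts at \<open>n - 1\<close> absorb the factors \<open>y n\<close> and \<open>x n\<close> in the last step of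
    the recursions.\<close>
  define v' where "v' i = (if i = n - 1 then v i - d * (1 / y n - 1) else v i)" for i
  define w' where "w' i = (if i = n - 1 then w i + d * (1 / x n - 1) else w i)" for i
  have v'_step: "v' (i-1) = xb i / yb i * v' i - d * (xb i / yb i + xb i / x i)"
    if i: "1 \<le> i" "i \<le> n - 1" for i
  proof -
    note nzi = nz(1)[of n] nz(1)[of i] nz(2)[of i]
    have "i - 1 \<noteq> n - 1"
      using i by linarith
    then have "v' (i-1) = v (i-1)"
      by (simp add: v'_def)
    also have "\<dots> = xb i * (v i / yb i - d * (1 / x i + (if i = n - 1 then 1 / (yb i * y n) else 1 / yb i)))"
    proof (cases "i = n - 1")
      case True
      with n have "i - 1 = n - 2" by simp
      then show ?thesis using v_last i nzi True by simp
    next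
      case False
      then show ?thesis using v[of i] i nzi by simp
    qed
    also have "\<dots> = xb i / yb i * v' i - d * (xb i / yb i + xb i / x i)"
      using i nzi n by (simp add: v'_def algebra_simps divide_inverse)
    finally show ?thesis .
  qed
  have w'_step: "w' (i-1) = y i / x i * w' i + d * (y i / x i + y i / yb i)"
    if i: "1 \<le> i" "i \<le> n - 1" for i
  proof -
    note nzi = nz(1)[of n] nz(1)[of i] nz(2)[of i]
    have "i - 1 \<noteq> n - 1"
      using i by linarith
    then have "w' (i-1) = w (i-1)"
      by (simp add: w'_def)
    also have "\<dots> = y i * (w i / x i + d * (1 / yb i + (if i = n - 1 then 1 / (x i * x n) else 1 / x i)))"
    proof (cases "i = n - 1")
      case True
      with n have "i - 1 = n - 2" by simp
      then show ?thesis using w_last i nzi True by (simp add: algebra_simps)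
    next
      case False
      then show ?thesis using w[of i] i nzi by (simp add: algebra_simps)
    qed
    also have "\<dots> = y i / x i * w' i + d * (y i / x i + y i / yb i)"
      using i nzi n by (simp add: w'_def algebra_simps divide_inverse)
    finally show ?thesis .
  qed
  have v'_0: "m \<le> n - 1 \<Longrightarrow> v' 0 = P m * v' m - d * (\<Sum>k=1..m. P (k-1) * (xb k / yb k + xb k / x k))" for m
  proof (induction m)
    case 0
    then show ?case by (simp add: P_def)
  next
    case (Suc m)
    then have "v' 0 = P m * v' m - d * (\<Sum>k=1..m. P (k-1) * (xb k / yb k + xb k / x k))"
      by simp
    also have "v' m = xb (Suc m) / yb (Suc m) * v' (Suc m) - d * (xb (Suc m) / yb (Suc m) + xb (Suc m) / x (Suc m))"
      using v'_step[of "Suc m"] Suc.prems by simp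
    finally show ?case
      by (simp add: P_Suc algebra_simps)
  qed
  have w'_0: "m \<le> n - 1 \<Longrightarrow> w' 0 = Q m * w' m + d * (\<Sum>k=1..m. Q (k-1) * (y k / x k + y k / yb k))" for m
  proof (induction m)
    case 0
    then show ?case by (simp add: Q_def)
  next
    case (Suc m)
    then have "w' 0 = Q m * w' m + d * (\<Sum>k=1..m. Q (k-1) * (y k / x k + y k / yb k))"
      by simp
    also have "w' m = y (Suc m) / x (Suc m) * w' (Suc m) + d * (y (Suc m) / x (Suc m) + y (Suc m) / yb (Suc m))"
      using w'_step[of "Suc m"] Suc.prems by simp
    finally show ?case
      by (simp add: Q_Suc algebra_simps)
  qed
  \<comment> \<open>These become the coefficients of \<open>level n (x, xb)\<close> and
    \<open>level n (y, yb)\<close> in \<open>V0\<close> once \<open>sum_prod_telescope\<close> is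
    applied.\<close>
  define A B where "A = (\<Sum>k=1..n-1. Q (k-1) * (y k / x k + y k / yb k)) - Q (n-1)"
    and "B = (\<Sum>k=1..n-1. P (k-1) * (xb k / yb k + xb k / x k)) - P (n-1)"
  have dA: "d * A = v 0 - Q (n-1) * (w (n-1) + d / x n)"
    using w'_0[of "n-1"] n start by (simp add: A_def w'_def field_simps)
  have dB: "d * B = P (n-1) * (v (n-1) - d / y n) - v 0"
    using v'_0[of "n-1"] n by (simp add: B_def v'_def field_simps)
  define Z where "Z = (\<Prod>i=1..n-1. xb i * y i)"
  have split: "prod f {1..n} = prod f {1..n-1} * f n" for f :: "nat \<Rightarrow> complex"
    using n by (cases n) auto
  have nzp: "prod x {1..n-1} \<noteq> 0" "prod yb {1..n-1} \<noteq> 0"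
    using nz by auto
  \<comment> \<open>All denominators of \<open>Q (n-1)\<close> are factors of the level. Together
    with \<open>ly\<close>, this gives the end terms of both chains the common factor
    \<open>Z\<close>.\<close>
  have lx: "level n (x, xb) * Q (n-1) = x n * Z"
    using nzp by (simp add: Q_def Z_def split[simplified] prod_dividef prod.distrib)
  have ly: "level n (y, yb) * P (n-1) = y n * Z"
    using nzp by (simp add: P_def Z_def split[simplified] prod_dividef prod.distrib)
  have "A = y 1 / yb 1 + (\<Sum>m=2..n-1. Q (m-1) * (1 + y m / yb m))"
    unfolding A_def Q_def using n by (subst sum_prod_telescope) auto
  moreover have "B = xb 1 / x 1 + (\<Sum>m=2..n-1. P (m-1) * (1 + xb m / x m))"
    unfolding B_def P_def using n by (subst sum_prod_telescope) auto
  ultimately have "V0 n ((x, xb), (y, yb)) = level n (x, xb) * A + level n (y, yb) * B + (x n * y n + 1) * Z"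
    unfolding V0.simps P_def Q_def Z_def by (simp add: algebra_simps del: level.simps One_nat_def)
  then have "d * V0 n ((x, xb), (y, yb))
      = level n (x, xb) * (d * A) + level n (y, yb) * (d * B) + d * (x n * y n + 1) * Z"
    by (simp only: algebra_simps)
  also have "\<dots> = d * v 0 - level n (x, xb) * Q (n-1) * (w (n-1) + d / x n)
      + level n (y, yb) * P (n-1) * (v (n-1) - d / y n) + d * (x n * y n + 1) * Z"
    unfolding dA dB by (simp only: d_def algebra_simps)
  \<comment> \<open>The bracket after \<open>Z\<close> is the difference of the two sides of
    \<open>close\<close>; dividing the remaining \<open>d * v 0\<close> by \<open>d\<close> yields
    the start value.\<close>
  also have "\<dots> = d * v 0 + Z * ((y n * v (n-1) - x n * w (n-1)) - d * (1 - x n * y n))"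
    unfolding lx ly using nz(1)[of n] n by (simp add: field_simps)
  finally have V0: "V0 n ((x, xb), (y, yb)) = v 0"
    using d close by simp
  \<comment> \<open>Once the start agrees, \<open>v\<close> and \<open>v_last\<close> are the
    defining recursion of \<open>V\<close> solved for the next value.\<close>
  from j show ?thesis
  proof (induction j)
    case 0
    then show ?case using V0 by simp
  next
    case (Suc j)
    then have IH: "V n j ((x, xb), (y, yb)) = v j" by simp
    show ?case
    proof (cases "Suc j = n - 1")
      case True
      then have j: "n - 2 = j" by simp
      note nzj = nz(1)[of n] nz(1)[of "Suc j"] nz(2)[of "Suc j"]
      have "v (Suc j) = yb (Suc j) * (v j / xb (Suc j) + d * (1 / x (Suc j) + 1 / (yb (Suc j) * y n)))"
        using v_last[unfolded j, folded True, symmetric] nzj True n by simp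
      also have "\<dots> = V n (Suc j) ((x, xb), (y, yb))"
        using nzj True n unfolding V.simps Let_def IH d_def[symmetric] by (simp add: field_simps)
      finally show ?thesis by simp
    next
      case False
      note nzj = nz(1)[of "Suc j"] nz(2)[of "Suc j"]
      have "v (Suc j) = yb (Suc j) * (v j / xb (Suc j) + d * (1 / x (Suc j) + 1 / yb (Suc j)))"
        using v[of "Suc j", symmetric] nzj False Suc.prems by simp
      also have "\<dots> = V n (Suc j) ((x, xb), (y, yb))"
        using nzj False Suc.prems unfolding V.simps Let_def IH d_def[symmetric] by (simp add: field_simps)
      finally show ?thesis by simp
    qed
  qed
qed

lemma level_sigmastar:
  assumes "n \<ge> 1" and "sigmastar n ((x, xb), (y, yb)) = (p, q)"
  shows "level n p = level n (y, yb)" "level n q = level n (x, xb)"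
proof -
  have split: "prod f {1..n} = prod f {1..n-1} * f n" for f :: "nat \<Rightarrow> complex"
    using assms by (cases n) auto
  have "prod (\<lambda>i. if i = n then y n else yb i) {1..n-1} = prod yb {1..n-1}"
    "prod (\<lambda>i. if i = n then x n else xb i) {1..n-1} = prod xb {1..n-1}"
    using assms(1) by (auto intro!: prod.cong)
  with assms split show "level n p = level n (y, yb)" "level n q = level n (x, xb)"
    by auto
qed


section \<open>The parameterization by tau functions\<close>

text \<open>The product at \<open>i = 1\<close> makes the formula for $z_2$ an instance of that for $z_i$, and the
  case $n = 3$ an instance of the general one.\<close>
definition tau_mid :: "(nat \<Rightarrow> complex) \<Rightarrow> nat \<Rightarrow> complex" where
  "tau_mid t i = (if i = 1 then t 0 * t 1 else t i)"

text \<open>A predicate on single entries rather than an equation of tuples: it treats all n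
  uniformly and can be checked entry by entry for the function updates that \<open>sigma1\<close>
  and \<open>sigman\<close> perform.\<close>

definition tau_param_eqs :: "nat \<Rightarrow> (nat \<Rightarrow> complex) \<Rightarrow> (nat \<Rightarrow> complex) \<Rightarrow> (nat \<Rightarrow> complex) \<Rightarrow>
    (nat \<Rightarrow> complex) \<Rightarrow> (nat \<Rightarrow> complex) \<Rightarrow> (nat \<Rightarrow> complex) \<Rightarrow> (nat \<Rightarrow> complex) \<Rightarrow> bool" where
  "tau_param_eqs n \<mu> \<mu>b t C t' z zb \<longleftrightarrow>
     z 1 = t 0 * t' 1 / (\<mu> 1 * C 1) \<and> zb 1 = t 1 * t' 0 / (\<mu>b 1 * C 1) \<and>
     (\<forall>i\<in>{2..n-2}. z i = C (i-1) * t' i / (\<mu> i * C i * tau_mid t' (i-1)) \<and>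
        zb i = C (i-1) * t i / (\<mu>b i * C i * tau_mid t (i-1))) \<and>
     z (n-1) = C (n-2) * t' (n-1) / (\<mu> (n-1) * t (n-1) * tau_mid t' (n-2)) \<and>
     zb (n-1) = C (n-2) * t n / (\<mu>b (n-1) * tau_mid t (n-2) * t' n) \<and>
     z n = t (n-1) * t' n / (\<mu> n * t n * t' (n-1))"

lemma tau_param_eqs_tau_param:
  assumes "n \<ge> 3" and "tau_param n (\<mu>, \<mu>b) t C t' = (z, zb)"
  shows "tau_param_eqs n \<mu> \<mu>b t C t' z zb"
proof (cases "n = 3")
  case True
  have z: "z = fst (tau_param n (\<mu>, \<mu>b) t C t')" and zb: "zb = snd (tau_param n (\<mu>, \<mu>b) t C t')"
    by (simp_all only: assms(2) fst_conv snd_conv)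
  show ?thesis
    unfolding tau_param_eqs_def z zb True by (simp add: tau_mid_def divide_inverse mult_ac)
next
  case False
  then have "4 \<le> n"
    using assms(1) by simp
  then obtain m where "n = 4 + m"
    using le_Suc_ex by blast
  \<comment> \<open>With n in successor form, simplification can evaluate the index comparisons in
    \<open>z\<close> and \<open>zb\<close>.\<close>
  then have m: "n = Suc (Suc (Suc (Suc m)))"
    by simp
  then have z: "z = (\<lambda>i\<in>{1..n}.
         if i = 1 then inverse (\<mu> 1) * (t 0 * t' 1 / C 1)
         else if i = 2 then inverse (\<mu> 2) * (C 1 * t' 2 / (C 2 * t' 0 * t' 1))
         else if i \<le> n - 2 then inverse (\<mu> i) * (C (i-1) * t' i / (C i * t' (i-1)))
         else if i = n - 1 then
           inverse (\<mu> (n-1)) * (C (n-2) * t' (n-1) / (t (n-1) * t' (n-2)))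
         else inverse (\<mu> n) * (t (n-1) * t' n / (t n * t' (n-1))))"
     and zb: "zb = (\<lambda>i\<in>{1..n-1}.
         if i = 1 then inverse (\<mu>b 1) * (t 1 * t' 0 / C 1)
         else if i = 2 then inverse (\<mu>b 2) * (C 1 * t 2 / (C 2 * t 0 * t 1))
         else if i \<le> n - 2 then inverse (\<mu>b i) * (C (i-1) * t i / (C i * t (i-1)))
         else inverse (\<mu>b (n-1)) * (C (n-2) * t n / (t (n-2) * t' n)))"
    using assms(2) False by (simp_all only: tau_param.simps prod.inject if_False)
  have "z 1 = t 0 * t' 1 / (\<mu> 1 * C 1)" "zb 1 = t 1 * t' 0 / (\<mu>b 1 * C 1)"
    using m unfolding z zb by (simp_all add: divide_inverse mult_ac)
  moreover have "z i = C (i-1) * t' i / (\<mu> i * C i * tau_mid t' (i-1)) \<and>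
        zb i = C (i-1) * t i / (\<mu>b i * C i * tau_mid t (i-1))" if "i \<in> {2..n-2}" for i
  proof (cases "i = 2")
    case True
    then show ?thesis
      using m unfolding z zb by (simp add: tau_mid_def divide_inverse mult_ac)
  next
    case False
    with that have "i \<noteq> 1" "i - 1 \<noteq> 1" "i \<in> {1..n}" "i \<in> {1..n-1}" "i \<le> n - 2"
      by auto
    with False show ?thesis
      unfolding z zb by (simp add: tau_mid_def divide_inverse mult_ac)
  qed
  moreover have "z (n-1) = C (n-2) * t' (n-1) / (\<mu> (n-1) * t (n-1) * tau_mid t' (n-2))"
     "zb (n-1) = C (n-2) * t n / (\<mu>b (n-1) * tau_mid t (n-2) * t' n)"
     "z n = t (n-1) * t' n / (\<mu> n * t n * t' (n-1))"
    using m unfolding z zb by (simp_all add: tau_mid_def divide_inverse mult_ac)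
  ultimately show ?thesis
    unfolding tau_param_eqs_def by blast
qed

lemma tau_mid_nonzero:
  assumes "\<And>i. i \<le> n \<Longrightarrow> t i \<noteq> 0" "i \<le> n"
  shows "tau_mid t i \<noteq> 0"
  using assms(1)[of i] assms(1)[of 0] assms(2) by (auto simp: tau_mid_def)

lemma tau_index_cases:
  fixes n i :: nat
  assumes "1 \<le> i" "i \<le> n" "n \<ge> 3"
  obtains "i = 1" | "2 \<le> i" "i \<le> n - 2" | "i = n - 1" | "i = n"
  using assms by linarith

lemma tau_param_eqs_nonzero:
  assumes n: "n \<ge> 3" and eqs: "tau_param_eqs n \<mu> \<mu>b t C t' z zb"
    and t: "\<And>i. i \<le> n \<Longrightarrow> t i \<noteq> 0" "\<And>i. i \<le> n \<Longrightarrow> t' i \<noteq> 0"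
    and C: "\<And>i. 1 \<le> i \<Longrightarrow> i \<le> n - 2 \<Longrightarrow> C i \<noteq> 0"
    and mu: "\<And>i. 1 \<le> i \<Longrightarrow> i \<le> n \<Longrightarrow> \<mu> i \<noteq> 0" "\<And>i. 1 \<le> i \<Longrightarrow> i \<le> n - 1 \<Longrightarrow> \<mu>b i \<noteq> 0"
  shows "1 \<le> i \<Longrightarrow> i \<le> n \<Longrightarrow> z i \<noteq> 0" "1 \<le> i \<Longrightarrow> i \<le> n - 1 \<Longrightarrow> zb i \<noteq> 0"
proof -
  have mid: "tau_mid t i \<noteq> 0" "tau_mid t' i \<noteq> 0" if "i \<le> n" for i
    using tau_mid_nonzero that t by metis+
  note nz = t C mu mid
  show "z i \<noteq> 0" if "1 \<le> i" "i \<le> n"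
    using that n by (cases rule: tau_index_cases) (use eqs nz n in \<open>auto simp: tau_param_eqs_def\<close>)
  show "zb i \<noteq> 0" if i: "1 \<le> i" "i \<le> n - 1"
  proof -
    from i have "i \<le> n" by simp
    from i(1) this n show ?thesis
      by (cases rule: tau_index_cases) (use eqs nz n i in \<open>auto simp: tau_param_eqs_def\<close>)
  qed
qed

text \<open>The product telescopes: up to index m all tau functions cancel except
  \<open>tau_mid t m * tau_mid t' m / (C m)\<^sup>2\<close>, and the entries at n - 1 and n cancel
  this remainder. Hence the level of a parameterized tuple is the reciprocal of the level of its
  coefficients.\<close>

lemma level_tau_param:
  assumes n: "n \<ge> 3" and eqs: "tau_param_eqs n \<mu> \<mu>b t C t' z zb"
    and t: "\<And>i. i \<le> n \<Longrightarrow> t i \<noteq> 0" "\<And>i. i \<le> n \<Longrightarrow> t' i \<noteq> 0"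
    and C: "\<And>i. 1 \<le> i \<Longrightarrow> i \<le> n - 2 \<Longrightarrow> C i \<noteq> 0"
    and mu: "\<And>i. 1 \<le> i \<Longrightarrow> i \<le> n \<Longrightarrow> \<mu> i \<noteq> 0" "\<And>i. 1 \<le> i \<Longrightarrow> i \<le> n - 1 \<Longrightarrow> \<mu>b i \<noteq> 0"
  shows "level n (z, zb) * level n (\<mu>, \<mu>b) = 1"
proof -
  have mid: "tau_mid t i \<noteq> 0" "tau_mid t' i \<noteq> 0" if "i \<le> n" for i
    using tau_mid_nonzero that t by metis+
  have prefix: "(\<Prod>i=1..m. z i * zb i * \<mu> i * \<mu>b i) = tau_mid t m * tau_mid t' m / (C m)\<^sup>2"
    if "1 \<le> m" "m \<le> n - 2" for m
    using that
  proof (induction m rule: dec_induct)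
    case base
    then show ?case using eqs mu[of 1] n C[of 1]
      by (simp add: tau_param_eqs_def tau_mid_def power2_eq_square)
  next
    case (step m)
    have *: "z (Suc m) = C m * t' (Suc m) / (\<mu> (Suc m) * C (Suc m) * tau_mid t' m)"
       "zb (Suc m) = C m * t (Suc m) / (\<mu>b (Suc m) * C (Suc m) * tau_mid t m)"
      using eqs step by (auto simp: tau_param_eqs_def dest!: bspec[of _ _ "Suc m"])
    have "tau_mid t (Suc m) = t (Suc m)" "tau_mid t' (Suc m) = t' (Suc m)"
      using step by (auto simp: tau_mid_def)
    then show ?case
      using step mid[of m] mu[of "Suc m"] C[of m] C[of "Suc m"] unfolding power2_eq_square
      by (simp add: *)
  qed
  obtain m where m: "n = Suc (Suc m)" "m \<ge> 1"
    using n by (metis Suc_le_D Suc_le_mono numeral_3_eq_3 One_nat_def)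
  have "level n (z, zb) * level n (\<mu>, \<mu>b)
    = (\<Prod>i=1..m. z i * zb i * \<mu> i * \<mu>b i) * z (n-1) * zb (n-1) * \<mu> (n-1) * \<mu>b (n-1) * z n * \<mu> n"
    by (simp add: m(1) prod.distrib mult_ac)
  also have "\<dots> = 1"
    using eqs n t[of n] t[of "n-1"] mid[of m] C[of m] mu(1)[of n] mu[of "n-1"] m
    by (simp add: prefix[of m, simplified] tau_param_eqs_def power2_eq_square)
  finally show ?thesis .
qed


lemma tau_param_extensional:
  assumes "n \<ge> 3" and "tau_param n (\<mu>, \<mu>b) t C t' = (z, zb)"
  shows "z \<in> extensional {1..n}" "zb \<in> extensional {1..n-1}"
proof -
  have "fst (tau_param n (\<mu>, \<mu>b) t C t') \<in> extensional {1..n} \<and>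
      snd (tau_param n (\<mu>, \<mu>b) t C t') \<in> extensional {1..n-1}"
    unfolding tau_param.simps by (cases "n = 3") simp_all
  with assms(2) show "z \<in> extensional {1..n}" "zb \<in> extensional {1..n-1}"
    by simp_all
qed

section \<open>Invariance of the level under the involutions\<close>

lemma level_sigma1:
  assumes "n \<ge> 2"
  shows "level n (sigma1_tuple (x, xb)) = level n (x, xb)"
proof -
  have *: "prod f {1..m} = f 1 * prod f {2..m}" if "m \<ge> 1" for f :: "nat \<Rightarrow> complex" and m
    using that by (simp add: prod.atLeast_Suc_atMost numeral_2_eq_2)
  have "prod (x(1 := xb 1)) {2..n} = prod x {2..n}"
    "prod (xb(1 := x 1)) {2..n-1} = prod xb {2..n-1}"
    by (auto intro!: prod.cong)
  then show ?thesis
    using assms *[of n x] *[of "n-1" xb] *[of n "x(1 := xb 1)"] *[of "n-1" "xb(1 := x 1)"]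
    by simp
qed

text \<open>The entries at n - 1 gain two factors \<open>x n\<close>, and inverting
  \<open>x n\<close> removes two. Like \<open>level_sigma1\<close>, this keeps \<open>d\<close>
  fixed when the data are replaced by their images under the involution.\<close>

lemma level_sigman:
  assumes "n \<ge> 2" "x n \<noteq> 0"
  shows "level n (sigman_tuple n (x, xb)) = level n (x, xb)"
proof -
  obtain m where m: "n = Suc (Suc m)"
    using assms(1) by (metis add_2_eq_Suc le_Suc_ex)
  have "prod (x(n - 1 := x (n-1) * x n, n := 1 / x n)) {1..m} = prod x {1..m}"
    "prod (xb(n - 1 := xb (n-1) * x n)) {1..m} = prod xb {1..m}"
    using m by (auto intro!: prod.cong)
  then show ?thesis using assms(2) m by simp
qed

text \<open>The relation between the two ends of the chains, in terms of tau functions. Unprimed and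
  primed tau functions belong to the indices n - 1 and n, \<open>u\<close> and \<open>u'\<close> are
  the values of \<open>t 0\<close> there, and \<open>kn\<close>, \<open>kl\<close> stand for
  \<open>kap n\<close>, \<open>lam n\<close>.\<close>

lemma closing_identity:
  fixes \<alpha> \<beta> :: complex
  assumes nz: "\<beta> \<noteq> 0" "u \<noteq> 0" "u' \<noteq> 0"
    and 2: "kn * kb * W * t1 + l * N * t3 = \<beta> * u * t2"
      "kb * W * t1' + l * kl * N * t3' = \<beta> * u' * t2'"
    and 3: "kb * W * t4' - lb * S * t2' = \<alpha> * u * t3'"
      "kn * kb * W * t4 - kl * lb * S * t2 = \<alpha> * u' * t3"
    and 4: "k * E * t3 + kl * lb * S * t1 = \<beta> * u * t4"
      "k * kn * E * t3' + lb * S * t1' = \<beta> * u' * t4'"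
  shows "\<beta> * (kl * t2 * t4' - kn * t2' * t4) = \<alpha> * (kn * kl * t1 * t3' - t1' * t3)"
    (is "?L = ?R")
proof -
  have "u * u' * (?L - ?R) = u' * kl * t4' * (\<beta> * u * t2) - kn * u * t4 * (\<beta> * u' * t2')
      - u' * t1 * kn * kl * (\<alpha> * u * t3') + u * t1' * (\<alpha> * u' * t3)"
    by (simp add: algebra_simps)
  \<comment> \<open>All terms containing \<open>W\<close> cancel here.\<close>
  also have "\<dots> = kl * N * l * (t4' * u' * t3 - kn * t4 * u * t3')
      + kl * lb * S * (kn * t1 * u' * t2' - t1' * u * t2)"
    unfolding 2[symmetric] 3[symmetric] by (simp add: algebra_simps)
  finally have "\<beta> * (u * u' * (?L - ?R)) = \<beta> * (kl * N * l * (t4' * u' * t3 - kn * t4 * u * t3')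
      + kl * lb * S * (kn * t1 * u' * t2' - t1' * u * t2))"
    by (rule arg_cong)
  also have "\<dots> = kl * N * l * (t3 * (\<beta> * u' * t4') - kn * t3' * (\<beta> * u * t4))
      + kl * lb * S * (kn * t1 * (\<beta> * u' * t2') - t1' * (\<beta> * u * t2))"
    by (simp add: algebra_simps)
  \<comment> \<open>Inside the first bracket the terms with \<open>E\<close> cancel, inside the
    second those with \<open>W\<close>; what remains are opposite multiples of
    \<open>kl * l * lb * N * S\<close>.\<close>
  also have "\<dots> = 0"
    unfolding 2[symmetric] 4[symmetric] by (simp add: algebra_simps)
  finally show ?thesis using nz by simp
qed


section \<open>Solutions of the bilinear equations\<close>

text \<open>A locale, so that every result can be reused for the data transformed by
  \<open>sigma1\<close> and \<open>sigman\<close>. With \<open>d\<close> as a parameter, the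
  constant \<open>c\<close> is literally the same in those interpretations.\<close>

locale bilinear_solution =
  fixes n :: nat and \<alpha> \<beta> d :: complex
    and lam lamb kap kapb :: "nat \<Rightarrow> complex"
    and S W N E :: "nat \<Rightarrow> complex" and t :: "nat \<Rightarrow> nat \<Rightarrow> complex"
    and x xb y yb :: "nat \<Rightarrow> complex"
  assumes n: "n \<ge> 3"
    and \<alpha>: "\<alpha> \<noteq> 0" and \<beta>: "\<beta> \<noteq> 0" and d: "d \<noteq> 0"
    and lam: "1 \<le> i \<Longrightarrow> i \<le> n \<Longrightarrow> lam i \<noteq> 0" "1 \<le> i \<Longrightarrow> i \<le> n - 1 \<Longrightarrow> lamb i \<noteq> 0"
    and kap: "1 \<le> i \<Longrightarrow> i \<le> n \<Longrightarrow> kap i \<noteq> 0" "1 \<le> i \<Longrightarrow> i \<le> n - 1 \<Longrightarrow> kapb i \<noteq> 0"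
    and SWNE: "1 \<le> i \<Longrightarrow> i \<le> n - 2 \<Longrightarrow> S i \<noteq> 0" "1 \<le> i \<Longrightarrow> i \<le> n - 2 \<Longrightarrow> W i \<noteq> 0"
      "1 \<le> i \<Longrightarrow> i \<le> n - 2 \<Longrightarrow> N i \<noteq> 0" "1 \<le> i \<Longrightarrow> i \<le> n - 2 \<Longrightarrow> E i \<noteq> 0"
    and t: "J \<le> 4 \<Longrightarrow> i \<le> n \<Longrightarrow> t J i \<noteq> 0"
    and bil: "bilinear_eqs n \<alpha> \<beta> (lam, lamb) (kap, kapb) S W N E t"
    and x: "tau_param_eqs n lam lamb (t 3) W (t 2) x xb"
    and y: "tau_param_eqs n kap kapb (t 2) N (t 1) y yb"
    and d_level: "d = level n (x, xb) - level n (y, yb)"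
begin

abbreviation "T J \<equiv> tau_mid (t J)"

definition c :: complex where "c = d * \<beta> / \<alpha>"

text \<open>The index shift at the end matters: \<open>v (n-1)\<close> contains the tau functions
  with index n, whereas \<open>w (n-1)\<close> contains those with index n - 1. At 0 the two chains
  share their value.\<close>

definition v :: "nat \<Rightarrow> complex" where
  "v i = (if i = 0 then c * t 2 0 * t 4 0 / (t 1 0 * t 3 0)
     else if i = n - 1 then c * t 2 n * t 4 n / (t 1 n * t 3 n)
     else c * S i * T 2 i / (N i * T 3 i))"

definition w :: "nat \<Rightarrow> complex" where
  "w i = (if i = 0 then c * t 2 0 * t 4 0 / (t 1 0 * t 3 0)
     else if i = n - 1 then c * t 2 (n-1) * t 4 (n-1) / (t 1 (n-1) * t 3 (n-1))
     else c * E i * T 2 i / (W i * T 1 i))"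

lemma c: "c \<noteq> 0" "c * \<alpha> = d * \<beta>"
  using \<alpha> \<beta> d by (simp_all add: c_def)

lemma T: "J \<le> 4 \<Longrightarrow> i \<le> n \<Longrightarrow> T J i \<noteq> 0"
  by (rule tau_mid_nonzero[where n = n]) (simp_all add: t)

lemma T_ge2: "2 \<le> i \<Longrightarrow> T J i = t J i"
  by (simp add: tau_mid_def)

lemma T_1: "T J 1 = t J 0 * t J 1"
  by (simp add: tau_mid_def)

lemmas x_nz = tau_param_eqs_nonzero[OF n x t t SWNE(2) lam, simplified]
lemmas y_nz = tau_param_eqs_nonzero[OF n y t t SWNE(3) kap, simplified]

text \<open>Common shape of all steps: \<open>X - Y = \<alpha> * p\<close> is an equation with \<open>J = 1\<close> or \<open>J = 3\<close>, and
  the formula for \<open>H\<close> comes from one with \<open>J = 2\<close>.\<close>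
lemma recursion_step:
  assumes "A = c * X * f" "B = c * Y * f" "H = \<beta> * p * f" "X - Y = \<alpha> * p"
  shows "A = B + d * H"
proof -
  have X: "X = Y + \<alpha> * p"
    using assms(4) by (simp add: algebra_simps)
  have "A = B + (c * \<alpha>) * p * f"
    unfolding assms(1,2) X by (simp add: algebra_simps)
  then show ?thesis by (simp add: c assms(3))
qed

text \<open>In the applications \<open>A\<close> and \<open>B\<close> are values of \<open>W\<close>
  and \<open>N\<close>, \<open>s\<close> is a value of \<open>t 2\<close> and \<open>u\<close> one
  of \<open>t 0\<close>. The equation with J = 2 makes the numerator a multiple of \<open>s\<close>,
  which then cancels.\<close>

lemma sum_of_fractions:
  fixes A B s :: complex
  assumes "A \<noteq> 0" "B \<noteq> 0" "s \<noteq> 0" "q * A + p * B = \<beta> * u * s"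
    and "a = p * F / (A * s)" "b = q * F / (B * s)"
  shows "a + b = \<beta> * u * F / (A * B)"
proof -
  have "a + b = (q * A + p * B) * F / (A * B * s)"
    using assms(1-3) unfolding assms(5,6) by (simp add: field_simps)
  then show ?thesis using assms(3,4) by simp
qed

section \<open>The sums of reciprocals, evaluated by the equations with J = 2\<close>

lemma sum_first: "1 / x 1 + 1 / yb 1 = \<beta> * t 0 1 / (t 3 0 * t 1 0)"
proof -
  have "1 / x 1 + 1 / yb 1 = (kapb 1 * N 1 * t 3 0 + lam 1 * W 1 * t 1 0) / (t 3 0 * t 2 1 * t 1 0)"
    using x y n t[of 1 0] t[of 2 1] t[of 3 0] by (simp add: tau_param_eqs_def field_simps)
  also have "kapb 1 * N 1 * t 3 0 + lam 1 * W 1 * t 1 0 = \<beta> * t 0 1 * t 2 1"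
    using bil by (simp add: bilinear_eqs_def)
  finally show ?thesis using t[of 2 1] n by simp
qed

lemma sum_interior:
  assumes i: "2 \<le> i" "i \<le> n - 2"
  shows "1 / x i + 1 / yb i = \<beta> * t 0 i * T 2 (i-1) / (W (i-1) * N (i-1))"
proof (rule sum_of_fractions)
  show "W (i-1) \<noteq> 0" "N (i-1) \<noteq> 0" "t 2 i \<noteq> 0"
    using i SWNE[of "i-1"] t[of 2 i] by auto
  show "(kapb i * N i) * W (i-1) + (lam i * W i) * N (i-1) = \<beta> * t 0 i * t 2 i"
    using bil i by (simp add: bilinear_eqs_def mult_ac)
  show "1 / x i = lam i * W i * T 2 (i-1) / (W (i-1) * t 2 i)"
    "1 / yb i = kapb i * N i * T 2 (i-1) / (N (i-1) * t 2 i)"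
    using x y i by (simp_all add: tau_param_eqs_def)
qed

text \<open>At n - 1 the two recursions contain different sums. The chain \<open>v\<close> uses the
  equation with index n - 1, and the chain \<open>w\<close> in \<open>sum_last_w\<close> the one
  with index n; \<open>sigman\<close> exchanges the two sums.\<close>

lemma sum_last_v:
  "1 / x (n-1) + 1 / (yb (n-1) * y n) = \<beta> * t 0 (n-1) * T 2 (n-2) / (W (n-2) * N (n-2))"
proof (rule sum_of_fractions)
  show "W (n-2) \<noteq> 0" "N (n-2) \<noteq> 0" "t 2 (n-1) \<noteq> 0"
    using n SWNE[of "n-2"] t[of 2 "n-1"] by auto
  show "(kap n * kapb (n-1) * t 1 (n-1)) * W (n-2) + (lam (n-1) * t 3 (n-1)) * N (n-2)
      = \<beta> * t 0 (n-1) * t 2 (n-1)"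
    using bil by (simp add: bilinear_eqs_def mult_ac)
  show "1 / x (n-1) = lam (n-1) * t 3 (n-1) * T 2 (n-2) / (W (n-2) * t 2 (n-1))"
    using x by (simp add: tau_param_eqs_def)
  show "1 / (yb (n-1) * y n) = kap n * kapb (n-1) * t 1 (n-1) * T 2 (n-2) / (N (n-2) * t 2 (n-1))"
    using y n t[of 1 n] t[of 2 n] by (simp add: tau_param_eqs_def mult_ac)
qed

lemma sum_last_w:
  "1 / yb (n-1) + 1 / (x (n-1) * x n) = \<beta> * t 0 n * T 2 (n-2) / (W (n-2) * N (n-2))"
proof -
  have "1 / (x (n-1) * x n) + 1 / yb (n-1) = \<beta> * t 0 n * T 2 (n-2) / (W (n-2) * N (n-2))"
  proof (rule sum_of_fractions)
    show "W (n-2) \<noteq> 0" "N (n-2) \<noteq> 0" "t 2 n \<noteq> 0"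
      using n SWNE[of "n-2"] t[of 2 n] by auto
    show "(kapb (n-1) * t 1 n) * W (n-2) + (lam (n-1) * lam n * t 3 n) * N (n-2) = \<beta> * t 0 n * t 2 n"
      using bil by (simp add: bilinear_eqs_def mult_ac)
    show "1 / yb (n-1) = kapb (n-1) * t 1 n * T 2 (n-2) / (N (n-2) * t 2 n)"
      using y by (simp add: tau_param_eqs_def mult_ac)
    show "1 / (x (n-1) * x n) = lam (n-1) * lam n * t 3 n * T 2 (n-2) / (W (n-2) * t 2 n)"
      using x n t[of 3 "n-1"] t[of 2 "n-1"] by (simp add: tau_param_eqs_def mult_ac)
  qed
  then show ?thesis by (simp add: add.commute)
qed

section \<open>The two chains satisfy the recursions and the closing relation\<close>

lemma v_step:
  assumes i: "1 \<le> i" "i \<le> n - 2"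
  shows "v i / yb i = v (i-1) / xb i + d * (1 / x i + 1 / yb i)"
proof (cases "i = 1")
  case True
  have n1: "Suc 0 \<noteq> n - Suc 0" "Suc 0 \<le> n - 2"
    using n by auto
  show ?thesis unfolding True
  \<comment> \<open>\<open>X\<close> and \<open>Y\<close> are the two products in the bilinear
    equation with J = 3 and index 1; \<open>f\<close> is the factor common to both sides of the
    recursion.\<close>
  proof (rule recursion_step[where X = "kapb 1 * S 1 * t 2 0" and Y = "lamb 1 * W 1 * t 4 0"
        and p = "t 0 1 * t 3 1" and f = "1 / (t 1 0 * t 3 0 * t 3 1)"])
    show "v 1 / yb 1 = c * (kapb 1 * S 1 * t 2 0) * (1 / (t 1 0 * t 3 0 * t 3 1))"
      using y n n1 SWNE[of 1] t[of 2 1] by (simp add: v_def tau_param_eqs_def T_1[simplified] mult_ac)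
    show "v (1-1) / xb 1 = c * (lamb 1 * W 1 * t 4 0) * (1 / (t 1 0 * t 3 0 * t 3 1))"
      using x n t[of 2 0] by (simp add: v_def tau_param_eqs_def mult_ac)
    show "1 / x 1 + 1 / yb 1 = \<beta> * (t 0 1 * t 3 1) * (1 / (t 1 0 * t 3 0 * t 3 1))"
      unfolding sum_first using t[of 3 1] n by simp
    show "kapb 1 * S 1 * t 2 0 - lamb 1 * W 1 * t 4 0 = \<alpha> * (t 0 1 * t 3 1)"
      using bil by (simp add: bilinear_eqs_def)
  qed
next
  case False
  with i have i: "2 \<le> i" "i \<le> n - 2" "i - 1 \<noteq> 0" "i - 1 \<noteq> n - 1" "i \<noteq> n - 1" "i \<noteq> 0" "1 \<le> i - 1" "i - 1 \<le> n - 2" "i - 1 \<le> n"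
    by auto
  show ?thesis
  proof (rule recursion_step[where X = "kapb i * W (i-1) * S i" and Y = "lamb i * S (i-1) * W i"
        and p = "t 0 i * t 3 i" and f = "T 2 (i-1) / (N (i-1) * W (i-1) * t 3 i)"])
    have "yb i = N (i-1) * t 2 i / (kapb i * N i * T 2 (i-1))"
      using y i by (simp add: tau_param_eqs_def)
    then show "v i / yb i = c * (kapb i * W (i-1) * S i) * (T 2 (i-1) / (N (i-1) * W (i-1) * t 3 i))"
      using i SWNE[of i] SWNE[of "i-1"] t[of 2 i] by (simp add: v_def T_ge2 mult_ac)
    have "xb i = W (i-1) * t 3 i / (lamb i * W i * T 3 (i-1))"
      using x i by (simp add: tau_param_eqs_def)
    then show "v (i-1) / xb i = c * (lamb i * S (i-1) * W i) * (T 2 (i-1) / (N (i-1) * W (i-1) * t 3 i))"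
      using i T[of 3 "i-1"] by (simp add: v_def mult_ac)
    show "1 / x i + 1 / yb i = \<beta> * (t 0 i * t 3 i) * (T 2 (i-1) / (N (i-1) * W (i-1) * t 3 i))"
      unfolding sum_interior[OF i(1,2)] using t[of 3 i] i by (simp add: mult_ac)
    show "kapb i * W (i-1) * S i - lamb i * S (i-1) * W i = \<alpha> * (t 0 i * t 3 i)"
      using bil i by (simp add: bilinear_eqs_def)
  qed
qed

lemma w_step:
  assumes i: "1 \<le> i" "i \<le> n - 2"
  shows "w i / x i = w (i-1) / y i - d * (1 / x i + 1 / yb i)"
proof -
  \<comment> \<open>With J = 1 the signs fit the recursion read backwards, so the earlier value
    stands on the left.\<close>
  have "w (i-1) / y i = w i / x i + d * (1 / x i + 1 / yb i)"
  proof (cases "i = 1")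
    case True
    have n1: "Suc 0 \<noteq> n - Suc 0" "Suc 0 \<le> n - 2"
      using n by auto
    show ?thesis unfolding True
    proof (rule recursion_step[where X = "kap 1 * N 1 * t 4 0" and Y = "lam 1 * E 1 * t 2 0"
          and p = "t 0 1 * t 1 1" and f = "1 / (t 1 0 * t 3 0 * t 1 1)"])
      show "w 1 / x 1 = c * (lam 1 * E 1 * t 2 0) * (1 / (t 1 0 * t 3 0 * t 1 1))"
        using x n n1 SWNE[of 1] t[of 2 1] by (simp add: w_def tau_param_eqs_def T_1[simplified] mult_ac)
      show "w (1-1) / y 1 = c * (kap 1 * N 1 * t 4 0) * (1 / (t 1 0 * t 3 0 * t 1 1))"
        using y n t[of 2 0] by (simp add: w_def tau_param_eqs_def mult_ac)
      show "1 / x 1 + 1 / yb 1 = \<beta> * (t 0 1 * t 1 1) * (1 / (t 1 0 * t 3 0 * t 1 1))"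
        unfolding sum_first using t[of 1 1] n by simp
      show "kap 1 * N 1 * t 4 0 - lam 1 * E 1 * t 2 0 = \<alpha> * (t 0 1 * t 1 1)"
        using bil by (simp add: bilinear_eqs_def)
    qed
  next
    case False
    with i have i: "2 \<le> i" "i \<le> n - 2" "i - 1 \<noteq> 0" "i - 1 \<noteq> n - 1" "i \<noteq> n - 1" "i \<noteq> 0" "1 \<le> i - 1" "i - 1 \<le> n - 2" "i - 1 \<le> n"
      by auto
    show ?thesis
    proof (rule recursion_step[where X = "kap i * E (i-1) * N i" and Y = "lam i * N (i-1) * E i"
          and p = "t 0 i * t 1 i" and f = "T 2 (i-1) / (N (i-1) * W (i-1) * t 1 i)"])
      have "x i = W (i-1) * t 2 i / (lam i * W i * T 2 (i-1))"
        using x i by (simp add: tau_param_eqs_def)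
      then show "w i / x i = c * (lam i * N (i-1) * E i) * (T 2 (i-1) / (N (i-1) * W (i-1) * t 1 i))"
        using i SWNE[of i] SWNE[of "i-1"] t[of 2 i] by (simp add: w_def T_ge2 mult_ac)
      have "y i = N (i-1) * t 1 i / (kap i * N i * T 1 (i-1))"
        using y i by (simp add: tau_param_eqs_def)
      then show "w (i-1) / y i = c * (kap i * E (i-1) * N i) * (T 2 (i-1) / (N (i-1) * W (i-1) * t 1 i))"
        using i T[of 1 "i-1"] by (simp add: w_def mult_ac)
      show "1 / x i + 1 / yb i = \<beta> * (t 0 i * t 1 i) * (T 2 (i-1) / (N (i-1) * W (i-1) * t 1 i))"
        unfolding sum_interior[OF i(1,2)] using t[of 1 i] i by (simp add: mult_ac)
      show "kap i * E (i-1) * N i - lam i * N (i-1) * E i = \<alpha> * (t 0 i * t 1 i)"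
        using bil i by (simp add: bilinear_eqs_def)
    qed
  qed
  then show ?thesis by simp
qed

lemma v_last:
  "v (n-1) / yb (n-1) = v (n-2) / xb (n-1) + d * (1 / x (n-1) + 1 / (yb (n-1) * y n))"
proof (rule recursion_step[where X = "kapb (n-1) * W (n-2) * t 4 n"
      and Y = "lamb (n-1) * S (n-2) * t 2 n"
      and p = "t 0 (n-1) * t 3 n" and f = "T 2 (n-2) / (N (n-2) * W (n-2) * t 3 n)"])
  have i: "n - 2 \<noteq> 0" "n - 2 \<noteq> n - 1" "n - 1 \<noteq> 0" "1 \<le> n - 2"
    using n by auto
  have "yb (n-1) = N (n-2) * t 2 n / (kapb (n-1) * T 2 (n-2) * t 1 n)"
    using y by (simp add: tau_param_eqs_def)
  then show "v (n-1) / yb (n-1) = c * (kapb (n-1) * W (n-2) * t 4 n) * (T 2 (n-2) / (N (n-2) * W (n-2) * t 3 n))"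
    using i SWNE[of "n-2"] t[of 2 n] t[of 1 n] by (simp add: v_def mult_ac)
  have "xb (n-1) = W (n-2) * t 3 n / (lamb (n-1) * T 3 (n-2) * t 2 n)"
    using x by (simp add: tau_param_eqs_def)
  then show "v (n-2) / xb (n-1) = c * (lamb (n-1) * S (n-2) * t 2 n) * (T 2 (n-2) / (N (n-2) * W (n-2) * t 3 n))"
    using i T[of 3 "n-2"] by (simp add: v_def mult_ac)
  show "1 / x (n-1) + 1 / (yb (n-1) * y n) = \<beta> * (t 0 (n-1) * t 3 n) * (T 2 (n-2) / (N (n-2) * W (n-2) * t 3 n))"
    unfolding sum_last_v using t[of 3 n] by (simp add: mult_ac)
  show "kapb (n-1) * W (n-2) * t 4 n - lamb (n-1) * S (n-2) * t 2 n = \<alpha> * (t 0 (n-1) * t 3 n)"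
    using bil by (simp add: bilinear_eqs_def)
qed

lemma w_last:
  "w (n-1) / x (n-1) = w (n-2) / y (n-1) - d * (1 / yb (n-1) + 1 / (x (n-1) * x n))"
proof -
  have i: "n - 2 \<noteq> 0" "n - 2 \<noteq> n - 1" "n - 1 \<noteq> 0" "1 \<le> n - 2"
    using n by auto
  have "w (n-2) / y (n-1) = w (n-1) / x (n-1) + d * (1 / yb (n-1) + 1 / (x (n-1) * x n))"
  proof (rule recursion_step[where X = "kap (n-1) * E (n-2) * t 2 (n-1)"
        and Y = "lam (n-1) * N (n-2) * t 4 (n-1)"
        and p = "t 0 n * t 1 (n-1)" and f = "T 2 (n-2) / (N (n-2) * W (n-2) * t 1 (n-1))"])
    have "x (n-1) = W (n-2) * t 2 (n-1) / (lam (n-1) * t 3 (n-1) * T 2 (n-2))"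
      using x by (simp add: tau_param_eqs_def)
    then show "w (n-1) / x (n-1) = c * (lam (n-1) * N (n-2) * t 4 (n-1)) * (T 2 (n-2) / (N (n-2) * W (n-2) * t 1 (n-1)))"
      using i SWNE[of "n-2"] t[of 2 "n-1"] t[of 3 "n-1"] by (simp add: w_def mult_ac)
    have "y (n-1) = N (n-2) * t 1 (n-1) / (kap (n-1) * t 2 (n-1) * T 1 (n-2))"
      using y by (simp add: tau_param_eqs_def)
    then show "w (n-2) / y (n-1) = c * (kap (n-1) * E (n-2) * t 2 (n-1)) * (T 2 (n-2) / (N (n-2) * W (n-2) * t 1 (n-1)))"
      using i T[of 1 "n-2"] by (simp add: w_def mult_ac)
    show "1 / yb (n-1) + 1 / (x (n-1) * x n) = \<beta> * (t 0 n * t 1 (n-1)) * (T 2 (n-2) / (N (n-2) * W (n-2) * t 1 (n-1)))"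
      unfolding sum_last_w using t[of 1 "n-1"] by (simp add: mult_ac)
    show "kap (n-1) * E (n-2) * t 2 (n-1) - lam (n-1) * N (n-2) * t 4 (n-1) = \<alpha> * (t 0 n * t 1 (n-1))"
      using bil by (simp add: bilinear_eqs_def)
  qed
  then show ?thesis by simp
qed

text \<open>Over the common denominator \<open>?D\<close> the two sides have numerators
  \<open>c * ?L\<close> and \<open>d * ?R\<close>. These agree by \<open>closing_identity\<close>,
  because \<open>c\<close> is \<open>d * \<beta> / \<alpha>\<close>.\<close>

lemma closing: "y n * v (n-1) - x n * w (n-1) = d * (1 - x n * y n)"
proof -
  let ?D = "kap n * lam n * t 1 (n-1) * t 3 n"
  have nz: "t J n \<noteq> 0" "t J (n-1) \<noteq> 0" if "J \<le> 4" for J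
    using t that by auto
  have ln: "lam n \<noteq> 0" "kap n \<noteq> 0" "n - 1 \<noteq> 0"
    using lam kap n by auto
  have xn: "x n = t 3 (n-1) * t 2 n / (lam n * t 3 n * t 2 (n-1))"
    and yn: "y n = t 2 (n-1) * t 1 n / (kap n * t 2 n * t 1 (n-1))"
    using x y by (simp_all add: tau_param_eqs_def)
  let ?L = "lam n * t 2 (n-1) * t 4 n - kap n * t 2 n * t 4 (n-1)"
  let ?R = "kap n * lam n * t 1 (n-1) * t 3 n - t 1 n * t 3 (n-1)"
  have *: "\<beta> * ?L = \<alpha> * ?R"
    by (rule closing_identity[where u = "t 0 (n-1)" and u' = "t 0 n" and kb = "kapb (n-1)"
          and lb = "lamb (n-1)" and W = "W (n-2)" and S = "S (n-2)" and N = "N (n-2)"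
          and E = "E (n-2)" and k = "kap (n-1)" and l = "lam (n-1)"])
      (use bil \<beta> t[of 0 n] t[of 0 "n-1"] in \<open>simp_all add: bilinear_eqs_def\<close>)
  have "c * ?L = d / \<alpha> * (\<beta> * ?L)"
    by (simp add: c_def)
  also have "\<dots> = d * ?R"
    using \<alpha> unfolding * by simp
  finally have cL: "c * ?L = d * ?R" .
  have yv: "y n * v (n-1) = c * (lam n * t 2 (n-1) * t 4 n) / ?D"
    using ln nz[of 1] nz[of 2] nz[of 3] by (simp add: v_def yn mult_ac)
  have xw: "x n * w (n-1) = c * (kap n * t 2 n * t 4 (n-1)) / ?D"
    using ln nz[of 1] nz[of 2] nz[of 3] by (simp add: w_def xn mult_ac)
  have xy: "1 - x n * y n = ?R / ?D"
    using ln nz[of 1] nz[of 2] nz[of 3] by (simp add: xn yn diff_divide_distrib mult_ac)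
  have "y n * v (n-1) - x n * w (n-1) = c * ?L / ?D"
    unfolding yv xw by (simp add: diff_divide_distrib right_diff_distrib)
  also have "\<dots> = d * (1 - x n * y n)"
    unfolding cL xy by simp
  finally show ?thesis .
qed

lemma v_0: "v 0 = c * t 2 0 * t 4 0 / (t 1 0 * t 3 0)"
  by (simp add: v_def)

lemma v_interior:
  assumes "1 \<le> i" "i \<le> n - 2"
  shows "v i = c * S i * T 2 i / (N i * T 3 i)"
proof -
  have "i \<noteq> 0" "i \<noteq> n - 1" using assms by auto
  then show ?thesis by (simp add: v_def)
qed

lemma v_end: "v (n-1) = c * t 2 n * t 4 n / (t 1 n * t 3 n)"
  using n by (simp add: v_def)

lemma w_interior:
  assumes "1 \<le> i" "i \<le> n - 2"
  shows "w i = c * E i * T 2 i / (W i * T 1 i)"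
proof -
  have "i \<noteq> 0" "i \<noteq> n - 1" using assms by auto
  then show ?thesis by (simp add: w_def)
qed

lemma w_end: "w (n-1) = c * t 2 (n-1) * t 4 (n-1) / (t 1 (n-1) * t 3 (n-1))"
  using n by (simp add: w_def)

lemma v_nonzero: "i \<le> n - 1 \<Longrightarrow> v i \<noteq> 0"
  using c(1) t T SWNE[of i] n by (simp add: v_def)

lemma w_nonzero: "i \<le> n - 1 \<Longrightarrow> w i \<noteq> 0"
  using c(1) t T SWNE[of i] n by (simp add: w_def)

section \<open>The values of V_i and of its conjugates under the involutions\<close>

lemma V_eq:
  assumes j: "j \<le> n - 1"
  shows "V n j ((x, xb), (y, yb)) = v j"
proof (rule V_eqI[where d = d and w = w])
  show "x i \<noteq> 0 \<and> y i \<noteq> 0" if "1 \<le> i" "i \<le> n" for i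
    using x_nz(1)[of i] y_nz(1)[of i] that by simp
  show "xb i \<noteq> 0 \<and> yb i \<noteq> 0" if "1 \<le> i" "i \<le> n - 1" for i
    using x_nz(2)[of i] y_nz(2)[of i] that by simp
  show "v 0 = w 0"
    by (simp add: v_def w_def)
  show "2 \<le> n"
    using n by simp
qed (fact d d_level v_step w_step v_last w_last closing j)+

lemma V_sigmastar:
  assumes j: "j \<le> n - 1"
  shows "V n j (sigmastar n ((x, xb), (y, yb))) = w j"
proof -
  define xs ys where "xs = (\<lambda>i\<in>{1..n}. if i = n then y n else yb i)"
    and "ys = (\<lambda>i\<in>{1..n}. if i = n then x n else xb i)"
  define xsb ysb where "xsb = (\<lambda>i\<in>{1..n-1}. y i)" and "ysb = (\<lambda>i\<in>{1..n-1}. x i)"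
  note defs = xs_def ys_def xsb_def ysb_def
  have star: "sigmastar n ((x, xb), (y, yb)) = ((xs, xsb), (ys, ysb))"
    by (simp add: defs)
  have s: "xs i = yb i" "ys i = xb i" "xsb i = y i" "ysb i = x i" if "1 \<le> i" "i \<le> n - 1" for i
    using that by (auto simp: defs)
  have s_n: "xs n = y n" "ys n = x n"
    using n by (auto simp: defs)
  have last: "1 \<le> n - 1"
    using n by simp
  have "V n j ((xs, xsb), (ys, ysb)) = w j"
  \<comment> \<open>For the transformed data the chains exchange their roles. The levels are
    exchanged too, hence the sign of \<open>d\<close>; the hypotheses are then the relations already
    proved for \<open>v\<close> and \<open>w\<close>.\<close>
  proof (rule V_eqI[where d = "-d" and w = v])
    show "- d = level n (xs, xsb) - level n (ys, ysb)"
      using level_sigmastar[OF _ star] n d_level by simp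
    show "xs i \<noteq> 0 \<and> ys i \<noteq> 0" if "1 \<le> i" "i \<le> n" for i
    proof (cases "i = n")
      case True
      then show ?thesis using s_n x_nz(1) y_nz(1) that by simp
    next
      case False
      with that have "i \<le> n - 1" by simp
      then show ?thesis using s[of i] x_nz(2) y_nz(2) that by simp
    qed
    show "xsb i \<noteq> 0 \<and> ysb i \<noteq> 0" if "1 \<le> i" "i \<le> n - 1" for i
      using s[of i] x_nz(1)[of i] y_nz(1)[of i] that by simp
    show "w i / ysb i = w (i-1) / xsb i + - d * (1 / xs i + 1 / ysb i)" if "1 \<le> i" "i \<le> n - 2" for i
      using w_step[OF that] s[of i] that by (simp add: algebra_simps)
    show "v i / xs i = v (i-1) / ys i - - d * (1 / xs i + 1 / ysb i)" if "1 \<le> i" "i \<le> n - 2" for i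
      using v_step[OF that] s[of i] that by (simp add: algebra_simps)
    show "w (n-1) / ysb (n-1) = w (n-2) / xsb (n-1) + - d * (1 / xs (n-1) + 1 / (ysb (n-1) * ys n))"
      using w_last s[of "n-1"] s_n last by (simp add: algebra_simps)
    show "v (n-1) / xs (n-1) = v (n-2) / ys (n-1) - - d * (1 / ysb (n-1) + 1 / (xs (n-1) * xs n))"
      using v_last s[of "n-1"] s_n last by (simp add: algebra_simps)
    show "ys n * w (n-1) - xs n * v (n-1) = - d * (1 - xs n * ys n)"
      using closing by (simp add: s_n algebra_simps)
  qed (use n d j in \<open>auto simp: v_def w_def\<close>)
  then show ?thesis by (simp only: star)
qed

text \<open>Exchanging the tau indices 0 and 1 together with the barred and unbarred first entries
  permutes the bilinear equations with these indices. The transformed data are therefore again a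
  solution, and its start value is that of \<open>v\<close> with 0 replaced by 1.\<close>

lemma V0_sigma1:
  "V n 0 (sigma1 ((x, xb), (y, yb))) = c * t 2 1 * t 4 1 / (t 1 1 * t 3 1)"
proof -
  define s :: "nat \<Rightarrow> nat" where "s i = (if i = 0 then 1 else if i = 1 then 0 else i)" for i
  have s_le: "s i \<le> n" if "i \<le> n" for i
    using that n by (auto simp: s_def)
  have s: "s 0 = 1" "s (Suc 0) = 0" "\<And>i. 2 \<le> i \<Longrightarrow> s i = i"
    by (auto simp: s_def)
  \<comment> \<open>At index 1 only the product of the values at 0 and 1 enters, which the exchange
    preserves.\<close>
  have mid: "tau_mid (\<lambda>i. f (s i)) i = tau_mid f i" if "1 \<le> i" for f :: "nat \<Rightarrow> complex" and i
    using that by (auto simp: tau_mid_def s_def)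
  have swap: "tau_param_eqs n (\<mu>(1 := \<mu>b 1)) (\<mu>b(1 := \<mu> 1)) (\<lambda>i. f (s i)) C (\<lambda>i. f' (s i))
      (z(1 := zb 1)) (zb(1 := z 1))"
    if "tau_param_eqs n \<mu> \<mu>b f C f' z zb" for \<mu> \<mu>b f C f' z zb
    using that n by (auto simp: tau_param_eqs_def s mid mult_ac)
  have index: "Suc 0 \<noteq> n - Suc 0" "Suc 0 \<noteq> n" "n \<noteq> 0" "2 \<le> n - Suc 0" "2 \<le> n" "\<not> n \<le> Suc 0"
    using n by auto
  have lev: "level n (z(1 := zb 1), zb(1 := z 1)) = level n (z, zb)" for z zb
    using level_sigma1[of n z zb] n by simp
  interpret s1: bilinear_solution n \<alpha> \<beta> d "lam(1 := lamb 1)" "lamb(1 := lam 1)"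
    "kap(1 := kapb 1)" "kapb(1 := kap 1)" S W N E "\<lambda>J i. t J (s i)"
    "x(1 := xb 1)" "xb(1 := x 1)" "y(1 := yb 1)" "yb(1 := y 1)"
  proof unfold_locales
    show "bilinear_eqs n \<alpha> \<beta> (lam(1 := lamb 1), lamb(1 := lam 1))
        (kap(1 := kapb 1), kapb(1 := kap 1)) S W N E (\<lambda>J i. t J (s i))"
      using bil index by (simp add: bilinear_eqs_def s)
    show "d = level n (x(1 := xb 1), xb(1 := x 1)) - level n (y(1 := yb 1), yb(1 := y 1))"
      unfolding lev by (rule d_level)
  qed (use n \<alpha> \<beta> d lam kap SWNE t s_le swap[OF x] swap[OF y] in auto)
  have "V n 0 (sigma1 ((x, xb), (y, yb))) = s1.v 0"
    using s1.V_eq[of 0] by (simp add: sigma1_def)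
  also have "\<dots> = c * t 2 1 * t 4 1 / (t 1 1 * t 3 1)"
    by (simp add: s1.v_0 s)
  finally show ?thesis .
qed

text \<open>The same argument with the tau indices n - 1 and n exchanged. It turns the end value of
  \<open>v\<close> into that of \<open>w\<close>, so on these data \<open>sigman\<close> and
  \<open>sigmastar\<close> give the same value.\<close>

lemma V_sigman:
  "V n (n-1) (sigman n ((x, xb), (y, yb))) = w (n-1)"
proof -
  define s :: "nat \<Rightarrow> nat" where "s i = (if i = n then n - 1 else if i = n - 1 then n else i)" for i
  have s_le: "s i \<le> n" if "i \<le> n" for i
    using that by (auto simp: s_def)
  have s: "s 0 = 0" "s (Suc 0) = Suc 0" "s n = n - Suc 0" "s (n - Suc 0) = n" "\<And>i. i \<le> n - 2 \<Longrightarrow> s i = i"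
    using n by (auto simp: s_def)
  have mid: "tau_mid (\<lambda>i. f (s i)) i = tau_mid f i" if "i \<le> n - 2" for f :: "nat \<Rightarrow> complex" and i
    using that s by (auto simp: tau_mid_def)
  have index: "Suc 0 \<noteq> n" "Suc 0 \<noteq> n - Suc 0" "n \<noteq> n - Suc 0" "n - 2 \<noteq> n - Suc 0" "n - 2 \<noteq> n"
    "\<And>i. i \<le> n - 2 \<Longrightarrow> i \<noteq> n \<and> i \<noteq> n - Suc 0" "\<And>i. i \<le> n - 2 \<Longrightarrow> i - Suc 0 \<le> n - 2"
    using n by auto
  have swap: "tau_param_eqs n (\<mu>(n - 1 := \<mu> (n-1) * \<mu> n, n := 1 / \<mu> n)) (\<mu>b(n - 1 := \<mu>b (n-1) * \<mu> n))
      (\<lambda>i. f (s i)) C (\<lambda>i. f' (s i)) (z(n - 1 := z (n-1) * z n, n := 1 / z n)) (zb(n - 1 := zb (n-1) * z n))"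
    if "tau_param_eqs n \<mu> \<mu>b f C f' z zb" and "f n \<noteq> 0" "f (n-1) \<noteq> 0" "f' n \<noteq> 0" "f' (n-1) \<noteq> 0"
    for \<mu> \<mu>b f C f' z zb
    unfolding tau_param_eqs_def
  proof (intro conjI ballI)
    fix i assume "i \<in> {2..n-2}"
    then show "(z(n - 1 := z (n-1) * z n, n := 1 / z n)) i = C (i-1) * f' (s i)
        / ((\<mu>(n - 1 := \<mu> (n-1) * \<mu> n, n := 1 / \<mu> n)) i * C i * tau_mid (\<lambda>i. f' (s i)) (i-1))"
      "(zb(n - 1 := zb (n-1) * z n)) i = C (i-1) * f (s i)
        / ((\<mu>b(n - 1 := \<mu>b (n-1) * \<mu> n)) i * C i * tau_mid (\<lambda>i. f (s i)) (i-1))"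
      using that(1) index(6,7)[of i] by (auto simp: tau_param_eqs_def s mid)
  qed (use that index n in \<open>simp_all add: tau_param_eqs_def s mid mult_ac\<close>)
  have lev: "level n (z(n - 1 := z (n-1) * z n, n := 1 / z n), zb(n - 1 := zb (n-1) * z n)) = level n (z, zb)"
    if "z n \<noteq> 0" for z zb
    using level_sigman[of n z zb] n that by simp
  have nzn: "x n \<noteq> 0" "y n \<noteq> 0" "lam n \<noteq> 0" "kap n \<noteq> 0"
    using x_nz y_nz lam kap n by auto
  interpret s1: bilinear_solution n \<alpha> \<beta> d "lam(n - 1 := lam (n-1) * lam n, n := 1 / lam n)"
    "lamb(n - 1 := lamb (n-1) * lam n)" "kap(n - 1 := kap (n-1) * kap n, n := 1 / kap n)"
    "kapb(n - 1 := kapb (n-1) * kap n)" S W N E "\<lambda>J i. t J (s i)"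
    "x(n - 1 := x (n-1) * x n, n := 1 / x n)" "xb(n - 1 := xb (n-1) * x n)"
    "y(n - 1 := y (n-1) * y n, n := 1 / y n)" "yb(n - 1 := yb (n-1) * y n)"
  proof unfold_locales
    show "bilinear_eqs n \<alpha> \<beta> (lam(n - 1 := lam (n-1) * lam n, n := 1 / lam n), lamb(n - 1 := lamb (n-1) * lam n))
        (kap(n - 1 := kap (n-1) * kap n, n := 1 / kap n), kapb(n - 1 := kapb (n-1) * kap n))
        S W N E (\<lambda>J i. t J (s i))"
      using bil nzn index n by (simp add: bilinear_eqs_def s mult_ac)
    show "d = level n (x(n - 1 := x (n-1) * x n, n := 1 / x n), xb(n - 1 := xb (n-1) * x n))
        - level n (y(n - 1 := y (n-1) * y n, n := 1 / y n), yb(n - 1 := yb (n-1) * y n))"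
      unfolding lev[of x xb, OF nzn(1)] lev[of y yb, OF nzn(2)] by (rule d_level)
    show "tau_param_eqs n (lam(n - 1 := lam (n-1) * lam n, n := 1 / lam n)) (lamb(n - 1 := lamb (n-1) * lam n))
      (\<lambda>i. t 3 (s i)) W (\<lambda>i. t 2 (s i)) (x(n - 1 := x (n-1) * x n, n := 1 / x n)) (xb(n - 1 := xb (n-1) * x n))"
      by (rule swap[OF x]) (use t in auto)
    show "tau_param_eqs n (kap(n - 1 := kap (n-1) * kap n, n := 1 / kap n)) (kapb(n - 1 := kapb (n-1) * kap n))
      (\<lambda>i. t 2 (s i)) N (\<lambda>i. t 1 (s i)) (y(n - 1 := y (n-1) * y n, n := 1 / y n)) (yb(n - 1 := yb (n-1) * y n))"
      by (rule swap[OF y]) (use t in auto)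
  qed (use n \<alpha> \<beta> d lam kap SWNE t s_le in auto)
  have "V n (n-1) (sigman n ((x, xb), (y, yb))) = s1.v (n-1)"
    using s1.V_eq[of "n-1"] by (simp add: sigman_def)
  also have "\<dots> = w (n-1)"
    unfolding s1.v_end w_end by (simp add: s)
  finally show ?thesis .
qed

section \<open>The values of U_i\<close>

definition u :: "nat \<Rightarrow> complex" where
  "u i = (if i = n - 1 then v (n-1) * w (n-1) else c\<^sup>2 * T 2 i * T 4 i / (T 1 i * T 3 i))"

lemma u_interior:
  assumes "i \<le> n - 2"
  shows "u i = c\<^sup>2 * T 2 i * T 4 i / (T 1 i * T 3 i)"
proof -
  have "i \<noteq> n - 1" using assms n by auto
  then show ?thesis by (simp add: u_def)
qed

lemma u_end: "u (n-1) = v (n-1) * w (n-1)"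
  by (simp add: u_def)

lemma u_nonzero: "i \<le> n - 1 \<Longrightarrow> u i \<noteq> 0"
  using v_nonzero[of "n-1"] w_nonzero[of "n-1"] c(1) T by (simp add: u_def)

lemma sum_nonzero:
  assumes "2 \<le> i" "i \<le> n - 2"
  shows "1 / x i + 1 / yb i \<noteq> 0"
  unfolding sum_interior[OF assms] using assms \<beta> t[of 0 i] T[of 2 "i-1"] SWNE[of "i-1"] by simp

text \<open>At i = 1 the product of V_0 and its conjugate joins the indices 0 and 1 into the values
  of \<open>T\<close> at 1. At n - 1 the indices n - 1 and n both occur, which is why
  \<open>u\<close> has a separate clause there.\<close>

lemma U_eq:
  assumes i: "1 \<le> i" "i \<le> n - 1"
  shows "U n i ((x, xb), (y, yb)) = u i"
proof -
  consider "i = 1" | "2 \<le> i" "i \<le> n - 2" | "i = n - 1"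
    using i by linarith
  then show ?thesis
  proof cases
    case 1
    have "U n i ((x, xb), (y, yb)) = v 0 * (c * t 2 1 * t 4 1 / (t 1 1 * t 3 1))"
      unfolding U.simps Let_def by (simp only: 1 refl if_True V_eq[of 0] V0_sigma1 le0)
    also have "\<dots> = u 1"
      using n by (simp add: u_interior v_0 T_1[simplified] power2_eq_square mult_ac)
    finally show ?thesis using 1 by simp
  next
    case 2
    then have j: "i \<noteq> 1" "i \<noteq> n - 1" "i - 1 \<le> n - 1" "1 \<le> i - 1" "i - 1 \<le> n - 2" "i \<le> n" "i - 1 \<le> n"
      by auto
    have "U n i ((x, xb), (y, yb)) = inverse (1 / x i + 1 / yb i)
        * (1 / y i * v i * w (i-1) + 1 / xb i * v (i-1) * w i)"
      unfolding U.simps Let_def using j i by (simp only: V_eq V_sigmastar if_False)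
    also have "1 / y i * v i * w (i-1) + 1 / xb i * v (i-1) * w i
        = (1 / x i + 1 / yb i) * u i"
    proof -
      let ?D = "N (i-1) * W (i-1) * t 1 i * t 3 i"
      note nz = SWNE[of i] SWNE[of "i-1"] t[OF _ \<open>i \<le> n\<close>] T[OF _ \<open>i - 1 \<le> n\<close>]
      have "1 / y i = kap i * N i * T 1 (i-1) / (N (i-1) * t 1 i)"
        "1 / xb i = lamb i * W i * T 3 (i-1) / (W (i-1) * t 3 i)"
        using x y 2 by (simp_all add: tau_param_eqs_def)
      then have "1 / y i * v i * w (i-1) = c\<^sup>2 * t 2 i * T 2 (i-1) / ?D * (kap i * E (i-1) * S i)"
        "1 / xb i * v (i-1) * w i = c\<^sup>2 * t 2 i * T 2 (i-1) / ?D * (lamb i * S (i-1) * E i)"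
        using 2 j nz by (simp_all add: v_interior w_interior T_ge2 power2_eq_square mult_ac)
      then have "1 / y i * v i * w (i-1) + 1 / xb i * v (i-1) * w i
          = c\<^sup>2 * t 2 i * T 2 (i-1) / ?D * (kap i * E (i-1) * S i + lamb i * S (i-1) * E i)"
        by (simp only: distrib_left)
      \<comment> \<open>The resulting factor \<open>\<beta> * t 0 i\<close> is also the one in
        \<open>sum_interior\<close>, so the inverse prefactor in \<open>U\<close> cancels.\<close>
      also have "kap i * E (i-1) * S i + lamb i * S (i-1) * E i = \<beta> * t 0 i * t 4 i"
        using bil 2 by (simp add: bilinear_eqs_def)
      also have "c\<^sup>2 * t 2 i * T 2 (i-1) / ?D * \<dots> = (1 / x i + 1 / yb i) * u i"
        unfolding sum_interior[OF 2] u_interior[OF 2(2)] using 2 by (simp add: T_ge2 mult_ac)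
      finally show ?thesis .
    qed
    finally show ?thesis
      using sum_nonzero[OF 2] by simp
  next
    case 3
    then have "i \<noteq> 1" using n by auto
    then show ?thesis
      unfolding U.simps Let_def using 3 by (simp only: V_eq V_sigmastar u_end if_False if_True refl le_refl)
  qed
qed

section \<open>The image under the tropical $R$\<close>

text \<open>All V_i, U_i and conjugates involved are by now monomials in tau functions, up to powers
  of \<open>c\<close>, so each component is a cancellation of monomials. Extensionality turns
  agreement on the index ranges into equality of functions.\<close>

lemma tropical_R_eq:
  assumes x': "tau_param_eqs n kap kapb (t 3) S (t 4) x' xb'"
    and y': "tau_param_eqs n lam lamb (t 4) E (t 1) y' yb'"
    and ext: "x' \<in> extensional {1..n}" "xb' \<in> extensional {1..n-1}"
      "y' \<in> extensional {1..n}" "yb' \<in> extensional {1..n-1}"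
  shows "tropical_R n ((x, xb), (y, yb)) = ((x', xb'), (y', yb'))"
proof -
  let ?p = "((x, xb), (y, yb))"
  \<comment> \<open>The value of V_0 under \<open>sigma1\<close>, from
    \<open>V0_sigma1\<close>.\<close>
  let ?V0s = "c * t 2 1 * t 4 1 / (t 1 1 * t 3 1)"
  note eqs = x[unfolded tau_param_eqs_def] y[unfolded tau_param_eqs_def]
    x'[unfolded tau_param_eqs_def] y'[unfolded tau_param_eqs_def]
  have n1: "Suc 0 \<le> n - 2" "n - Suc (Suc 0) = n - 2" using n by auto
  note nz1 = c(1) SWNE[of 1] t[of _ 0] t[of _ 1] n n1 kap[of 1] lam[of 1]
  have first: "y 1 * (?V0s / v 1) = x' 1" "yb 1 * (v 0 / v 1) = xb' 1"
    "x 1 * (v 0 / w 1) = y' 1" "xb 1 * (?V0s / w 1) = yb' 1"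
    using nz1 eqs by (simp_all add: v_0 v_interior w_interior T_1[simplified] mult_ac)
  have step: "y i * (v (i-1) * u i / (v i * u (i-1))) = x' i" "yb i * (v (i-1) / v i) = xb' i"
    "x i * (w (i-1) / w i) = y' i" "xb i * (w (i-1) * u i / (w i * u (i-1))) = yb' i"
    if i: "2 \<le> i" "i \<le> n - 1" for i
  proof -
    have j: "1 \<le> i - 1" "i - 1 \<le> n - 2" "i - 1 \<le> n" "i \<le> n" using i by auto
    note nzi = c(1) SWNE[OF j(1,2)] T[OF _ j(3)] t[OF _ j(4)] kap[of i] lam[of i]
    have "y i * (v (i-1) * u i / (v i * u (i-1))) = x' i \<and> yb i * (v (i-1) / v i) = xb' i \<and>
      x i * (w (i-1) / w i) = y' i \<and> xb i * (w (i-1) * u i / (w i * u (i-1))) = yb' i"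
    proof (cases "i = n - 1")
      case False
      with i have i': "i \<le> n - 2" by simp
      note at = v_interior[OF _ i'] w_interior[OF _ i'] u_interior[OF i']
        v_interior[OF j(1,2), simplified One_nat_def] w_interior[OF j(1,2), simplified One_nat_def]
        u_interior[OF j(2), simplified One_nat_def] T_ge2[OF i(1)]
      have "y i = N (i-1) * t 1 i / (kap i * N i * T 1 (i-1))" "yb i = N (i-1) * t 2 i / (kapb i * N i * T 2 (i-1))"
        "x i = W (i-1) * t 2 i / (lam i * W i * T 2 (i-1))" "xb i = W (i-1) * t 3 i / (lamb i * W i * T 3 (i-1))"
        "x' i = S (i-1) * t 4 i / (kap i * S i * T 4 (i-1))" "xb' i = S (i-1) * t 3 i / (kapb i * S i * T 3 (i-1))"
        "y' i = E (i-1) * t 1 i / (lam i * E i * T 1 (i-1))" "yb' i = E (i-1) * t 4 i / (lamb i * E i * T 4 (i-1))"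
        using eqs i(1) i' by simp_all
      then show ?thesis
        using nzi i i' SWNE[of i] by (simp add: at power2_eq_square mult_ac)
    next
      case True
      then have k: "i - 1 = n - 2" by simp
      note nze = t[of _ n] nzi[unfolded k, unfolded True]
      have m: "1 \<le> n - 2" "n - 2 \<le> n - 2" using n by auto
      have "y (n-1) = N (n-2) * t 1 (n-1) / (kap (n-1) * t 2 (n-1) * T 1 (n-2))"
        "yb (n-1) = N (n-2) * t 2 n / (kapb (n-1) * T 2 (n-2) * t 1 n)"
        "x (n-1) = W (n-2) * t 2 (n-1) / (lam (n-1) * t 3 (n-1) * T 2 (n-2))"
        "xb (n-1) = W (n-2) * t 3 n / (lamb (n-1) * T 3 (n-2) * t 2 n)"
        "x' (n-1) = S (n-2) * t 4 (n-1) / (kap (n-1) * t 3 (n-1) * T 4 (n-2))"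
        "xb' (n-1) = S (n-2) * t 3 n / (kapb (n-1) * T 3 (n-2) * t 4 n)"
        "y' (n-1) = E (n-2) * t 1 (n-1) / (lam (n-1) * t 4 (n-1) * T 1 (n-2))"
        "yb' (n-1) = E (n-2) * t 4 n / (lamb (n-1) * T 4 (n-2) * t 1 n)"
        using eqs by simp_all
      then show ?thesis
        unfolding k unfolding True using nze
        by (simp add: u_end[simplified One_nat_def] v_end[simplified One_nat_def] w_end[simplified One_nat_def]
            v_interior[OF m] w_interior[OF m] u_interior[OF m(2)] power2_eq_square mult_ac)
    qed
    then show "y i * (v (i-1) * u i / (v i * u (i-1))) = x' i" "yb i * (v (i-1) / v i) = xb' i"
      "x i * (w (i-1) / w i) = y' i" "xb i * (w (i-1) * u i / (w i * u (i-1))) = yb' i"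
      by auto
  qed
  \<comment> \<open>Here \<open>w (n-1)\<close> stands for the value under \<open>sigman\<close>, by
    \<open>V_sigman\<close>.\<close>
  have last: "y n * (v (n-1) / w (n-1)) = x' n" "x n * (w (n-1) / v (n-1)) = y' n"
    using c(1) t[of _ n] t[of _ "n-1"] kap[of n] lam[of n] eqs n
    by (simp_all add: v_end[simplified] w_end[simplified] mult_ac)
  have V: "V n j ?p = v j" "V n j (sigmastar n ?p) = w j" if "j \<le> n - 1" for j
    using V_eq V_sigmastar that by auto
  have "(\<lambda>i\<in>{1..n}. if i = 1 then y 1 * (V n 0 (sigma1 ?p) / V n 1 ?p)
         else if i \<le> n - 1 then y i * (V n (i-1) ?p * U n i ?p / (V n i ?p * U n (i-1) ?p))
         else y n * (V n (n-1) ?p / V n (n-1) (sigman n ?p))) = x'"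
  proof (rule extensionalityI[OF restrict_extensional ext(1)])
    fix i assume "i \<in> {1..n}"
    then consider "i = 1" | "2 \<le> i" "i \<le> n - 1" "i \<noteq> 1" | "i = n" "i \<noteq> 1" "\<not> i \<le> n - 1"
      using n by fastforce
    then show "(\<lambda>i\<in>{1..n}. if i = 1 then y 1 * (V n 0 (sigma1 ?p) / V n 1 ?p)
         else if i \<le> n - 1 then y i * (V n (i-1) ?p * U n i ?p / (V n i ?p * U n (i-1) ?p))
         else y n * (V n (n-1) ?p / V n (n-1) (sigman n ?p))) i = x' i"
    proof cases
      case 1
      then show ?thesis
        using first(1) V(1)[of 1] V0_sigma1 n by (simp del: V.simps)
    next
      case 2
      then have "1 \<le> i - 1" "i - 1 \<le> n - 1" "1 \<le> i" "i \<le> n" by auto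
      then show ?thesis
        using 2 step(1)[of i] V(1)[of i] V(1)[of "i-1"] U_eq[of i] U_eq[of "i-1"]
        by (simp del: V.simps U.simps sigmastar.simps)
    next
      case 3
      then show ?thesis
        using last(1) V(1)[of "n-1"] V_sigman n by (simp del: V.simps)
    qed
  qed
  moreover have "(\<lambda>i\<in>{1..n-1}. if i = 1 then yb 1 * (V n 0 ?p / V n 1 ?p)
         else yb i * (V n (i-1) ?p / V n i ?p)) = xb'"
  proof (rule extensionalityI[OF restrict_extensional ext(2)])
    fix i assume "i \<in> {1..n-1}"
    then have i: "1 \<le> i" "i \<le> n - 1" "i - 1 \<le> n - 1" "i \<noteq> 1 \<Longrightarrow> 1 \<le> i - 1" "i \<noteq> 1 \<Longrightarrow> 2 \<le> i" by auto
    show "(\<lambda>i\<in>{1..n-1}. if i = 1 then yb 1 * (V n 0 ?p / V n 1 ?p)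
         else yb i * (V n (i-1) ?p / V n i ?p)) i = xb' i"
      using first(2) step(2)[of i] V(1)[of 0] V(1)[of 1] V(1)[of i] V(1)[of "i-1"] i
      by (cases "i = 1") (simp_all del: V.simps)
  qed
  moreover have "(\<lambda>i\<in>{1..n}. if i = 1 then x 1 * (V n 0 ?p / V n 1 (sigmastar n ?p))
         else if i \<le> n - 1 then x i * (V n (i-1) (sigmastar n ?p) / V n i (sigmastar n ?p))
         else x n * (V n (n-1) (sigman n ?p) / V n (n-1) ?p)) = y'"
  proof (rule extensionalityI[OF restrict_extensional ext(3)])
    fix i assume "i \<in> {1..n}"
    then consider "i = 1" | "2 \<le> i" "i \<le> n - 1" "i \<noteq> 1" | "i = n" "i \<noteq> 1" "\<not> i \<le> n - 1"
      using n by fastforce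
    then show "(\<lambda>i\<in>{1..n}. if i = 1 then x 1 * (V n 0 ?p / V n 1 (sigmastar n ?p))
         else if i \<le> n - 1 then x i * (V n (i-1) (sigmastar n ?p) / V n i (sigmastar n ?p))
         else x n * (V n (n-1) (sigman n ?p) / V n (n-1) ?p)) i = y' i"
    proof cases
      case 1
      then show ?thesis
        using first(3) V(1)[of 0] V(2)[of 1] n by (simp del: V.simps sigmastar.simps)
    next
      case 2
      then have "i - 1 \<le> n - 1" "1 \<le> i" "i \<le> n" by auto
      then show ?thesis
        using 2 step(3)[of i] V(2)[of i] V(2)[of "i-1"] by (simp del: V.simps sigmastar.simps)
    next
      case 3
      then show ?thesis
        using last(2) V(1)[of "n-1"] V_sigman n by (simp del: V.simps)
    qed
  qed
  moreover have "(\<lambda>i\<in>{1..n-1}. if i = 1 then xb 1 * (V n 0 (sigma1 ?p) / V n 1 (sigmastar n ?p))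
         else xb i * (V n (i-1) (sigmastar n ?p) * U n i ?p
                      / (V n i (sigmastar n ?p) * U n (i-1) ?p))) = yb'"
  proof (rule extensionalityI[OF restrict_extensional ext(4)])
    fix i assume "i \<in> {1..n-1}"
    then have i: "1 \<le> i" "i \<le> n - 1" "i - 1 \<le> n - 1" "i \<noteq> 1 \<Longrightarrow> 1 \<le> i - 1" "i \<noteq> 1 \<Longrightarrow> 2 \<le> i" by auto
    show "(\<lambda>i\<in>{1..n-1}. if i = 1 then xb 1 * (V n 0 (sigma1 ?p) / V n 1 (sigmastar n ?p))
         else xb i * (V n (i-1) (sigmastar n ?p) * U n i ?p
                      / (V n i (sigmastar n ?p) * U n (i-1) ?p))) i = yb' i"
      using first(4) step(4)[of i] V0_sigma1 V(2)[of 1] V(2)[of i] V(2)[of "i-1"]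
        U_eq[of i] U_eq[of "i-1"] i
      by (cases "i = 1") (simp_all del: V.simps U.simps sigmastar.simps)
  qed
  ultimately show ?thesis
    unfolding tropical_R.simps Let_def by (simp only:)
qed

text \<open>The denominators are products and quotients of tau functions and of the constants
  \<open>c\<close> and \<open>\<beta>\<close>, none of which vanishes.\<close>

lemma in_tropical_R_domain:
  assumes "((x, xb), (y, yb)) \<in> calB n \<times> calB n"
    and "tropical_R n ((x, xb), (y, yb)) \<in> calB n \<times> calB n"
  shows "((x, xb), (y, yb)) \<in> tropical_R_domain n"
proof -
  have "1 / x i + 1 / yb i \<noteq> 0" if "i \<in> {2..n-2}" for i
    using sum_nonzero that by simp
  moreover have "V n i ((x, xb), (y, yb)) \<noteq> 0 \<and> V n i (sigmastar n ((x, xb), (y, yb))) \<noteq> 0"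
    if "i \<in> {1..n-1}" for i
    using that V_eq[of i] V_sigmastar[of i] v_nonzero[of i] w_nonzero[of i] by (simp del: V.simps sigmastar.simps)
  moreover have "U n i ((x, xb), (y, yb)) \<noteq> 0" if "i \<in> {1..n-2}" for i
  proof -
    from that have "1 \<le> i" "i \<le> n - 1" by auto
    then show ?thesis using U_eq[of i] u_nonzero[of i] by (simp del: U.simps)
  qed
  moreover have "V n (n-1) (sigman n ((x, xb), (y, yb))) \<noteq> 0"
    using V_sigman w_nonzero[of "n-1"] by (simp del: V.simps)
  ultimately show ?thesis
    using assms unfolding tropical_R_domain_def mem_Collect_eq fst_conv snd_conv by blast
qed

end

section \<open>Membership in the domain and the conclusion\<close>

lemma tau_param_in_calB:
  assumes n: "n \<ge> 3" and eq: "tau_param n (\<mu>, \<mu>b) t C t' = (z, zb)"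
    and t: "\<And>i. i \<le> n \<Longrightarrow> t i \<noteq> 0" "\<And>i. i \<le> n \<Longrightarrow> t' i \<noteq> 0"
    and C: "\<And>i. 1 \<le> i \<Longrightarrow> i \<le> n - 2 \<Longrightarrow> C i \<noteq> 0"
    and mu: "\<And>i. 1 \<le> i \<Longrightarrow> i \<le> n \<Longrightarrow> \<mu> i \<noteq> 0" "\<And>i. 1 \<le> i \<Longrightarrow> i \<le> n - 1 \<Longrightarrow> \<mu>b i \<noteq> 0"
  shows "(z, zb) \<in> calB n"
  using tau_param_extensional[OF n eq]
    tau_param_eqs_nonzero[OF n tau_param_eqs_tau_param[OF n eq] t C mu]
  by (auto simp: calB_def PiE_iff)

theorem theorem4p4:
  fixes n :: nat
    and \<alpha> \<beta> :: complex
    and lam kap x y x' y' :: tuple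
    and S W N E :: "nat \<Rightarrow> complex"
    and \<tau> :: "nat \<Rightarrow> nat \<Rightarrow> complex"
  assumes "n \<ge> 3"
    and "lam \<in> calB n" and "kap \<in> calB n"
    and "level n lam * level n kap * (level n lam - level n kap) \<noteq> 0"
    and "\<alpha> \<noteq> 0" and "\<beta> \<noteq> 0"
    and "\<forall>i\<in>{1..n-2}. S i \<noteq> 0 \<and> W i \<noteq> 0 \<and> N i \<noteq> 0 \<and> E i \<noteq> 0"
    and "\<forall>J\<in>{0..4}. \<forall>i\<in>{0..n}. \<tau> J i \<noteq> 0"
    and "bilinear_eqs n \<alpha> \<beta> lam kap S W N E \<tau>"
    and "x = tau_param n lam (\<tau> 3) W (\<tau> 2)"
    and "y = tau_param n kap (\<tau> 2) N (\<tau> 1)"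
    and "x' = tau_param n kap (\<tau> 3) S (\<tau> 4)"
    and "y' = tau_param n lam (\<tau> 4) E (\<tau> 1)"
  shows "(x, y) \<in> tropical_R_domain n \<and> tropical_R n (x, y) = (x', y')"
proof -
  note n = assms(1)
  obtain l lb k kb x1 xb1 y1 yb1 x2 xb2 y2 yb2
    where pairs: "lam = (l, lb)" "kap = (k, kb)" "x = (x1, xb1)" "y = (y1, yb1)"
      "x' = (x2, xb2)" "y' = (y2, yb2)"
    by (metis surj_pair)
  have lam: "1 \<le> i \<Longrightarrow> i \<le> n \<Longrightarrow> l i \<noteq> 0" "1 \<le> i \<Longrightarrow> i \<le> n - 1 \<Longrightarrow> lb i \<noteq> 0"
    and kap: "1 \<le> i \<Longrightarrow> i \<le> n \<Longrightarrow> k i \<noteq> 0" "1 \<le> i \<Longrightarrow> i \<le> n - 1 \<Longrightarrow> kb i \<noteq> 0" for i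
    using assms(2,3) by (auto simp: pairs calB_def PiE_iff)
  have C: "1 \<le> i \<Longrightarrow> i \<le> n - 2 \<Longrightarrow> S i \<noteq> 0" "1 \<le> i \<Longrightarrow> i \<le> n - 2 \<Longrightarrow> W i \<noteq> 0"
    "1 \<le> i \<Longrightarrow> i \<le> n - 2 \<Longrightarrow> N i \<noteq> 0" "1 \<le> i \<Longrightarrow> i \<le> n - 2 \<Longrightarrow> E i \<noteq> 0" for i
    using assms(7) by auto
  have t: "\<tau> J i \<noteq> 0" if "J \<le> 4" "i \<le> n" for J i
    using assms(8) that by auto
  have tJ: "i \<le> n \<Longrightarrow> \<tau> 1 i \<noteq> 0" "i \<le> n \<Longrightarrow> \<tau> 2 i \<noteq> 0" "i \<le> n \<Longrightarrow> \<tau> 3 i \<noteq> 0" "i \<le> n \<Longrightarrow> \<tau> 4 i \<noteq> 0" for i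
    by (simp_all add: t)
  have param: "tau_param n (l, lb) (\<tau> 3) W (\<tau> 2) = (x1, xb1)"
    "tau_param n (k, kb) (\<tau> 2) N (\<tau> 1) = (y1, yb1)"
    "tau_param n (k, kb) (\<tau> 3) S (\<tau> 4) = (x2, xb2)"
    "tau_param n (l, lb) (\<tau> 4) E (\<tau> 1) = (y2, yb2)"
    using assms(10-13) by (simp_all only: pairs)
  note eqs = param[THEN tau_param_eqs_tau_param[OF n]]
  have inv: "level n (x1, xb1) * level n lam = 1" "level n (y1, yb1) * level n kap = 1"
    unfolding pairs(1,2) using level_tau_param[OF n eqs(1) tJ(3,2) C(2) lam]
      level_tau_param[OF n eqs(2) tJ(2,1) C(3) kap] by blast+
  \<comment> \<open>By \<open>inv\<close> the levels of x and y are the reciprocals of those of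
    \<open>lam\<close> and \<open>kap\<close>; if they agreed, \<open>lam\<close> and
    \<open>kap\<close> would have equal levels.\<close>
  have d: "level n (x1, xb1) - level n (y1, yb1) \<noteq> 0"
  proof
    assume "level n (x1, xb1) - level n (y1, yb1) = 0"
    with inv have "level n (x1, xb1) * level n lam = level n (x1, xb1) * level n kap"
      "level n (x1, xb1) \<noteq> 0"
      by (auto simp del: level.simps)
    then show False using assms(4) by (simp del: level.simps)
  qed
  interpret bilinear_solution n \<alpha> \<beta> "level n (x1, xb1) - level n (y1, yb1)" l lb k kb S W N E \<tau> x1 xb1 y1 yb1
    using assms(9) unfolding pairs(1,2)
    by unfold_locales (use n assms(5,6) d lam kap C t eqs(1,2) in \<open>simp_all del: level.simps\<close>)
  have R: "tropical_R n (x, y) = (x', y')"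
    unfolding pairs
    by (rule tropical_R_eq[OF eqs(3,4)]) (rule tau_param_extensional[OF n param(3)] tau_param_extensional[OF n param(4)])+
  \<comment> \<open>Membership of \<open>x'\<close> and \<open>y'\<close> gives the last clause of
    \<open>tropical_R_domain\<close>, that the image lies in the target set.\<close>
  have "x \<in> calB n" "y \<in> calB n" "x' \<in> calB n" "y' \<in> calB n"
    unfolding pairs(3-6)
    using tau_param_in_calB[OF n param(1) tJ(3,2) C(2) lam] tau_param_in_calB[OF n param(2) tJ(2,1) C(3) kap]
      tau_param_in_calB[OF n param(3) tJ(3,4) C(1) kap] tau_param_in_calB[OF n param(4) tJ(4,1) C(4) lam]
    by blast+
  then have "(x, y) \<in> calB n \<times> calB n" "tropical_R n (x, y) \<in> calB n \<times> calB n"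
    unfolding R by simp_all
  then have "(x, y) \<in> tropical_R_domain n"
    unfolding pairs by (rule in_tropical_R_domain)
  from this R show ?thesis by (rule conjI)
qed

end
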